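(* Let $G$ be a connected finite graph. Let $h$ be a function analytic on the open disk $D=\{z\in\mathbb C:|z|<\rho(W_{1,\omega})+\epsilon\}$ for some $\epsilon>0$ (for the characters $\omega$ under consideration; in (b) and (d) for all of them), and let $\hat h(l)=\frac{1}{2\pi\sqrt{-1}}\oint_C h(z)z^{-l-1}\,dz$, where $C$ is a counterclockwise simple closed path in $D$ around the origin. Then: (a) $\sum_{\lambda\in\operatorname{spec}W_{1,\omega}}(h(\lambda)-h(0))=\sum_{l\ge1}\sum_{\alpha\in H_1(G,\mathbb Z)}\chi_\omega(\alpha)N(\alpha,l)\hat h(l)$; (b) for $\alpha\in H_1(G,\mathbb Z)$, $\int_{\mathcal X}\chi_{-\omega}(\alpha)\Big(\sum_{\lambda\in\operatorname{spec}W_{1,\omega}}(h(\lambda)-h(0))\Big)dV_\omega=\operatorname{vol}(\mathcal X)\cdot\sum_{l\ge1}N(\alpha,l)\hat h(l)$; (c) for $\underline{\omega}\in\widehat{Q_\Lambda}$, $\sum_{\lambda\in\operatorname{spec}W_{1,\omega}}(h(\lambda)-h(0))=\sum_{l\ge1}\sum_{\underline{\alpha}\in Q_\Lambda}\chi_{\underline{\omega}}(\underline{\alpha})N(\underline{\alpha},l)\hat h(l)$; (d) for $\underline{\alpha}\in Q_\Lambda$, $\sum_{\underline{\omega}\in\widehat{Q_\Lambda}}\chi_{-\underline{\omega}}(\underline{\alpha})\sum_{\lambda\in\operatorname{spec}W_{1,\omega}}(h(\lambda)-h(0))=|Q_\Lambda|\cdot\sum_{l\ge1}N(\underline{\alpha},l)\hat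 h(l)$.
   Context: $G$: connected finite graph (multiple edges, loops allowed), $n$ vertices, $m$ edges, genus $g=m-n+1$; $\mathbf E(G)$ its $2m$ oriented edges, $\mathbf a(0),\mathbf a(1)$ initial/terminal vertex, $\mathbf a^{-1}$ inverse. Fix positively oriented edges $\mathbf e_1,\dots,\mathbf e_m$; $\mathcal T(G)$ = real span of $\mathbf e_i$ (with $\mathbf e_i^{-1}=-\mathbf e_i$), $\Omega(G)$ its dual with orthonormal dual basis $d\mathbf e_i$. $H_1(G,\mathbb Z)$ = integer combinations of the $\mathbf e_i$ with zero boundary. $\mathcal H^1(G)$ = harmonic $1$-forms (at each vertex the coefficients on incoming positively oriented edges sum to those on outgoing ones); every $\omega$ is uniquely harmonic part $\phi_1(\omega)$ plus an exact form $\sum_i(f(\mathbf e_i(1))-f(\mathbf e_i(0)))d\mathbf e_i$. $H_1(G,\mathbb Z)^\vee=\{\eta\in\mathcal H^1(G):\eta(H_1(G,\mathbb Z))\subseteq\mathbb Z\}$; $\mathcal X=\mathcal H^1(G)/H_1(G,\mathbb Z)^\vee$, $\underline\omega=\phi_1(\omega)+H_1(G,\mathbb Z)^\vee$; $dV_\omega$ is the volume form on $\mathcal X$ induced by the inner product on $\mathcal H^1(G)$ and $\operatorname{vol}(\mathcal X)$ its total volume. $\chi_\omega(\alpha)=\exp(2\pi\sqrt{-1}\,\omega(\alpha))$; on $H_1(G,\mathbb Z)$ it depends only on $\underline\omega$. $\mathbf a$ feeds into $\mathbf b$ if $\mathbf a(1)=\mathbf b(0)$, $\mathbf b\neq\mathbf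 a^{-1}$; $W_{1,\omega}$ is the $2m\times 2m$ matrix with $(W_{1,\omega})_{\mathbf a\mathbf b}=\chi_\omega(\mathbf b)$ if $\mathbf a$ feeds into $\mathbf b$, else $0$; $\operatorname{spec}$ = multiset of eigenvalues, $\rho$ = spectral radius. A walk is a sequence $\mathbf a_1\cdots\mathbf a_N$ of oriented edges with $\mathbf a_{i+1}(0)=\mathbf a_i(1)$, of length $N$; a circuit is a closed walk ($\mathbf a_N(1)=\mathbf a_1(0)$) with no backtrack ($\mathbf a_{i+1}\neq\mathbf a_i^{-1}$) and no tail ($\mathbf a_N\neq\mathbf a_1^{-1}$); its abelianization is $C^{ab}=\mathbf a_1+\dots+\mathbf a_N\in H_1(G,\mathbb Z)$. $N(\alpha,l)$ is the number of circuits $C$ of length $l$ with $C^{ab}=\alpha$. $\Lambda$ is a subgroup of finite index in $H_1(G,\mathbb Z)$, $Q_\Lambda=H_1(G,\mathbb Z)/\Lambda$, $\underline\alpha=\alpha+\Lambda$, $N(\underline\alpha,l)$ = number of circuits $C$ of length $l$ with $C^{ab}+\Lambda=\underline\alpha$; $\Lambda^\vee=\{\eta\in\mathcal H^1(G):\eta(\Lambda)\subseteq\mathbb Z\}$ and $\widehat{Q_\Lambda}=\Lambda^\vee/H_1(G,\mathbb Z)^\vee\subseteq\mathcal X$; for $\underline\omega\in\widehat{Q_\Lambda}$, $\chi_{\underline\omega}(\underline\alpha):=\chi_\omega(\alpha)$ is well defined. *)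

theory Defs
  imports
    "HOL-Complex_Analysis.Complex_Analysis"
    "Graph_Theory.Digraph_Component"
    "Jordan_Normal_Form.Spectral_Radius"
begin

(* these clash with the notation of HOL-Analysis *)
no_notation Matrix.vec_index (infixl \<open>$\<close> 100)
no_notation Matrix.scalar_prod (infix \<open>\<bullet>\<close> 70)

section \<open>Oriented edges, walks and circuits\<close>

text \<open>
  A finite graph with a fixed choice of positively oriented edges is a \<^locale>\<open>fin_digraph\<close>
  whose arcs are the positively oriented edges; loops and multiple arcs are allowed.
  The oriented edge \<open>(e, True)\<close> is the arc \<open>e\<close> itself and \<open>(e, False)\<close> is its inverse, so that
  a loop also gives two distinct oriented edges.
\<close>

type_synonym 'e oedge = "'e \<times> bool"

definition oriented_edges :: "('v,'e) pre_digraph \<Rightarrow> 'e oedge set" where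
  "oriented_edges G = arcs G \<times> UNIV"

definition initial_vertex :: "('v,'e) pre_digraph \<Rightarrow> 'e oedge \<Rightarrow> 'v" where
  "initial_vertex G a = (if snd a then tail G (fst a) else head G (fst a))"

definition terminal_vertex :: "('v,'e) pre_digraph \<Rightarrow> 'e oedge \<Rightarrow> 'v" where
  "terminal_vertex G a = (if snd a then head G (fst a) else tail G (fst a))"

definition inv_edge :: "'e oedge \<Rightarrow> 'e oedge" where
  "inv_edge a = (fst a, \<not> snd a)"

definition feeds_into :: "('v,'e) pre_digraph \<Rightarrow> 'e oedge \<Rightarrow> 'e oedge \<Rightarrow> bool" where
  "feeds_into G a b \<longleftrightarrow> terminal_vertex G a = initial_vertex G b \<and> b \<noteq> inv_edge a"

definition is_walk :: "('v,'e) pre_digraph \<Rightarrow> 'e oedge list \<Rightarrow> bool" where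
  "is_walk G c \<longleftrightarrow> c \<noteq> [] \<and> set c \<subseteq> oriented_edges G \<and>
     (\<forall>i. Suc i < length c \<longrightarrow> initial_vertex G (c ! Suc i) = terminal_vertex G (c ! i))"

definition is_circuit :: "('v,'e) pre_digraph \<Rightarrow> 'e oedge list \<Rightarrow> bool" where
  "is_circuit G c \<longleftrightarrow> is_walk G c \<and>
     terminal_vertex G (last c) = initial_vertex G (hd c) \<and>
     (\<forall>i. Suc i < length c \<longrightarrow> c ! Suc i \<noteq> inv_edge (c ! i)) \<and>
     last c \<noteq> inv_edge (hd c)"

section \<open>Chains, cycles and 1-forms\<close>

text \<open>
  Chains are given by their coordinates with respect to the positively oriented edges and
  1-forms by their coordinates with respect to the dual basis; both are vectors in
  \<open>real ^ 'e\<close> that vanish outside \<open>arcs G\<close> (the set of arcs need not exhaust the type \<open>'e\<close>, so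
  that graphs without edges are included). In these coordinates the evaluation
  \<open>\<omega>(\<alpha>)\<close> of a form on a chain and the inner product of two forms are both \<open>(\<bullet>)\<close>.
\<close>

definition chains :: "('v,'e::finite) pre_digraph \<Rightarrow> (real ^ 'e) set" where
  "chains G = {\<alpha>. \<forall>e. e \<notin> arcs G \<longrightarrow> \<alpha> $ e = 0}"

definition one_forms :: "('v,'e::finite) pre_digraph \<Rightarrow> (real ^ 'e) set" where
  "one_forms G = {\<omega>. \<forall>e. e \<notin> arcs G \<longrightarrow> \<omega> $ e = 0}"

definition edge_chain :: "'e oedge \<Rightarrow> real ^ ('e::finite)" where
  "edge_chain a = (if snd a then axis (fst a) 1 else - axis (fst a) 1)"

definition abelianization :: "'e oedge list \<Rightarrow> real ^ ('e::finite)" where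
  "abelianization c = (\<Sum>a\<leftarrow>c. edge_chain a)"

definition H1 :: "('v,'e::finite) pre_digraph \<Rightarrow> (real ^ 'e) set" where
  "H1 G = {\<alpha> \<in> chains G. (\<forall>e. \<alpha> $ e \<in> \<int>) \<and>
     (\<forall>v\<in>verts G. (\<Sum>e | e \<in> arcs G \<and> head G e = v. \<alpha> $ e)
                 - (\<Sum>e | e \<in> arcs G \<and> tail G e = v. \<alpha> $ e) = 0)}"

definition harmonic_forms :: "('v,'e::finite) pre_digraph \<Rightarrow> (real ^ 'e) set" where
  "harmonic_forms G = {\<omega> \<in> one_forms G.
     \<forall>v\<in>verts G. (\<Sum>e | e \<in> arcs G \<and> head G e = v. \<omega> $ e)
                = (\<Sum>e | e \<in> arcs G \<and> tail G e = v. \<omega> $ e)}"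

definition exact_forms :: "('v,'e::finite) pre_digraph \<Rightarrow> (real ^ 'e) set" where
  "exact_forms G = {\<omega> \<in> one_forms G.
     \<exists>f :: 'v \<Rightarrow> real. \<forall>e\<in>arcs G. \<omega> $ e = f (head G e) - f (tail G e)}"

definition harmonic_part :: "('v,'e::finite) pre_digraph \<Rightarrow> real ^ 'e \<Rightarrow> real ^ 'e" where
  "harmonic_part G \<omega> = (THE \<eta>. \<eta> \<in> harmonic_forms G \<and> \<omega> - \<eta> \<in> exact_forms G)"

definition dual_lattice :: "('v,'e::finite) pre_digraph \<Rightarrow> (real ^ 'e) set \<Rightarrow> (real ^ 'e) set" where
  "dual_lattice G \<Lambda> = {\<eta> \<in> harmonic_forms G. \<forall>\<alpha>\<in>\<Lambda>. \<eta> \<bullet> \<alpha> \<in> \<int>}"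

section \<open>Characters and quotients\<close>

definition coset :: "'a::ab_group_add set \<Rightarrow> 'a \<Rightarrow> 'a set" where
  "coset L x = (+) x ` L"

definition char_torus :: "('v,'e::finite) pre_digraph \<Rightarrow> (real ^ 'e) set set" where
  "char_torus G = coset (dual_lattice G (H1 G)) ` harmonic_forms G"

definition form_class :: "('v,'e::finite) pre_digraph \<Rightarrow> real ^ 'e \<Rightarrow> (real ^ 'e) set" where
  "form_class G \<omega> = coset (dual_lattice G (H1 G)) (harmonic_part G \<omega>)"

definition chr :: "real ^ 'e \<Rightarrow> real ^ ('e::finite) \<Rightarrow> complex" where
  "chr \<omega> \<alpha> = exp (2 * of_real pi * \<i> * of_real (\<omega> \<bullet> \<alpha>))"

definition finite_index_subgroup ::
  "('v,'e::finite) pre_digraph \<Rightarrow> (real ^ 'e) set \<Rightarrow> bool" where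
  "finite_index_subgroup G \<Lambda> \<longleftrightarrow> \<Lambda> \<subseteq> H1 G \<and> 0 \<in> \<Lambda> \<and> (\<forall>\<alpha>\<in>\<Lambda>. \<forall>\<beta>\<in>\<Lambda>. \<alpha> - \<beta> \<in> \<Lambda>) \<and>
     finite (coset \<Lambda> ` H1 G)"

definition quot :: "('v,'e::finite) pre_digraph \<Rightarrow> (real ^ 'e) set \<Rightarrow> (real ^ 'e) set set" where
  "quot G \<Lambda> = coset \<Lambda> ` H1 G"

definition quot_dual :: "('v,'e::finite) pre_digraph \<Rightarrow> (real ^ 'e) set \<Rightarrow> (real ^ 'e) set set" where
  "quot_dual G \<Lambda> = coset (dual_lattice G (H1 G)) ` dual_lattice G \<Lambda>"

text \<open>
  A quantity \<open>f \<omega>\<close> depending only on the class of \<open>\<omega>\<close>, as a function on classes, and likewise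
  the value of a character on a coset of \<open>\<Lambda>\<close>.
\<close>

definition on_class :: "('v,'e::finite) pre_digraph \<Rightarrow> (real ^ 'e \<Rightarrow> 'b) \<Rightarrow> (real ^ 'e) set \<Rightarrow> 'b" where
  "on_class G f x = the_elem (f ` {\<omega> \<in> one_forms G. form_class G \<omega> = x})"

definition chr_coset :: "real ^ 'e \<Rightarrow> (real ^ ('e::finite)) set \<Rightarrow> complex" where
  "chr_coset \<omega> A = the_elem (chr \<omega> ` A)"

section \<open>The volume form on the character torus\<close>

text \<open>
  Lebesgue measure of a linear subspace with the induced inner product, as a Borel measure on the
  ambient space concentrated on \<open>V\<close>: the image of the product of one-dimensional Lebesgue measures
  under the coordinates of an orthonormal basis.
\<close>

definition orthonormal_basis :: "'a::euclidean_space set \<Rightarrow> 'a set" where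
  "orthonormal_basis V =
     (SOME B. B \<subseteq> V \<and> pairwise Linear_Algebra.orthogonal B \<and> (\<forall>b\<in>B. norm b = 1) \<and> span B = V)"

definition subspace_lebesgue :: "'a::euclidean_space set \<Rightarrow> 'a measure" where
  "subspace_lebesgue V =
     distr (Pi\<^sub>M (orthonormal_basis V) (\<lambda>_. lborel)) borel
       (\<lambda>c. \<Sum>b\<in>orthonormal_basis V. c b *\<^sub>R b)"

definition fundamental_domain :: "'a::euclidean_space set \<Rightarrow> 'a set \<Rightarrow> 'a set \<Rightarrow> bool" where
  "fundamental_domain V L F \<longleftrightarrow>
     F \<in> sets borel \<and> F \<subseteq> V \<and> (\<forall>x\<in>V. \<exists>!y. y \<in> F \<and> x - y \<in> L)"

text \<open>
  The measure induced on \<open>V / L\<close>, on the quotient of the Borel sigma-algebra: Lebesgue measure of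
  a fundamental domain, pushed forward. It does not depend on the fundamental domain.
\<close>

definition quotient_volume :: "'a::euclidean_space set \<Rightarrow> 'a set \<Rightarrow> 'a set measure" where
  "quotient_volume V L =
     distr (restrict_space (subspace_lebesgue V) (SOME F. fundamental_domain V L F))
       (sigma (coset L ` V) {A. A \<subseteq> coset L ` V \<and> \<Union>A \<in> sets borel})
       (coset L)"

definition dV :: "('v,'e::finite) pre_digraph \<Rightarrow> (real ^ 'e) set measure" where
  "dV G = quotient_volume (harmonic_forms G) (dual_lattice G (H1 G))"

section \<open>Edge matrices and circuit counts\<close>

text \<open>The list \<open>es\<close> enumerates the positively oriented edges \<open>e\<^sub>1, \<dots>, e\<^sub>m\<close>.\<close>

definition oriented_list :: "'e list \<Rightarrow> 'e oedge list" where
  "oriented_list es = map (\<lambda>e. (e, True)) es @ map (\<lambda>e. (e, False)) es"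

definition W1 :: "('v,'e::finite) pre_digraph \<Rightarrow> 'e list \<Rightarrow> real ^ 'e \<Rightarrow> complex mat" where
  "W1 G es \<omega> = Matrix.mat (2 * length es) (2 * length es) (\<lambda>(i, j).
     let a = oriented_list es ! i; b = oriented_list es ! j
     in if feeds_into G a b then chr \<omega> (edge_chain b) else 0)"

definition spec :: "complex mat \<Rightarrow> complex multiset" where
  "spec A = proots (char_poly A)"

(* spectral_radius is unspecified for the 0 x 0 matrix, which occurs for the one-vertex graph *)
definition rho :: "complex mat \<Rightarrow> real" where
  "rho A = (if spectrum A = {} then 0 else spectral_radius A)"

definition num_circuits :: "('v,'e::finite) pre_digraph \<Rightarrow> real ^ 'e \<Rightarrow> nat \<Rightarrow> nat" where
  "num_circuits G \<alpha> l = card {c. is_circuit G c \<and> length c = l \<and> abelianization c = \<alpha>}"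

definition num_circuits_mod ::
  "('v,'e::finite) pre_digraph \<Rightarrow> (real ^ 'e) set \<Rightarrow> (real ^ 'e) set \<Rightarrow> nat \<Rightarrow> nat" where
  "num_circuits_mod G \<Lambda> A l =
     card {c. is_circuit G c \<and> length c = l \<and> coset \<Lambda> (abelianization c) = A}"

section \<open>Test functions\<close>

text \<open>
  The disk \<open>|z| < \<rho>(W\<^sub>1\<^sub>,\<^sub>\<omega>) + \<epsilon>\<close>, for all characters \<open>\<omega>\<close> in a set \<open>S\<close>: these disks are
  concentric, so their union is the disk of the largest radius.
\<close>

definition disk ::
  "('v,'e::finite) pre_digraph \<Rightarrow> 'e list \<Rightarrow> (real ^ 'e) set \<Rightarrow> real \<Rightarrow> complex set" where
  "disk G es S \<epsilon> = (\<Union>\<omega>\<in>S. {z. norm z < rho (W1 G es \<omega>) + \<epsilon>})"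

definition ccw_loop_in :: "complex set \<Rightarrow> (real \<Rightarrow> complex) \<Rightarrow> bool" where
  "ccw_loop_in D \<gamma> \<longleftrightarrow> valid_path \<gamma> \<and> simple_path \<gamma> \<and> pathfinish \<gamma> = pathstart \<gamma> \<and>
     path_image \<gamma> \<subseteq> D - {0} \<and> winding_number \<gamma> 0 = 1"

definition test_function ::
  "('v,'e::finite) pre_digraph \<Rightarrow> 'e list \<Rightarrow> (real ^ 'e) set \<Rightarrow> real \<Rightarrow>
    (complex \<Rightarrow> complex) \<Rightarrow> (real \<Rightarrow> complex) \<Rightarrow> bool" where
  "test_function G es S \<epsilon> h \<gamma> \<longleftrightarrow>
     \<epsilon> > 0 \<and> h analytic_on disk G es S \<epsilon> \<and> ccw_loop_in (disk G es S \<epsilon>) \<gamma>"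

definition coef :: "(complex \<Rightarrow> complex) \<Rightarrow> (real \<Rightarrow> complex) \<Rightarrow> nat \<Rightarrow> complex" where
  "coef h \<gamma> l = 1 / (2 * of_real pi * \<i>) * contour_integral \<gamma> (\<lambda>z. h z * z powi (- int l - 1))"

definition spec_sum ::
  "('v,'e::finite) pre_digraph \<Rightarrow> 'e list \<Rightarrow> (complex \<Rightarrow> complex) \<Rightarrow> real ^ 'e \<Rightarrow> complex" where
  "spec_sum G es h \<omega> = (\<Sum>z\<in>#spec (W1 G es \<omega>). h z - h 0)"

end

theory Submission
  imports Defs
begin

text \<open>
  Traces of powers of \<open>W\<^sub>1\<^sub>,\<^sub>\<omega>\<close> count circuits weighted by \<open>\<chi>\<^sub>\<omega>\<close>, so expanding \<open>h\<close> in its Taylor series at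
  \<open>0\<close> and summing over the eigenvalues gives (a), and grouping the circuits by their class modulo
  \<open>\<Lambda>\<close> gives (c). Parts (b) and (d) follow by orthogonality of characters, on the torus and on
  \<open>Q\<^sub>\<Lambda>\<close> respectively. On the torus the volume is translation invariant, and a nonzero cycle \<open>\<beta>\<close> has
  character value \<open>-1\<close> at the harmonic form \<open>\<beta> / (2 |\<beta>|\<^sup>2)\<close>, so its character integrates to \<open>0\<close>; the sum
  over \<open>l\<close> is dominated by the trivial character \<open>\<omega> = 0\<close>. On \<open>Q\<^sub>\<Lambda>\<close> one needs that a cycle outside
  \<open>\<Lambda>\<close> is detected by \<open>\<Lambda>\<^sup>\<or>\<close>, and summing the pairing of \<open>Q\<^sub>\<Lambda>\<close> with its dual in both orders shows
  that they have equally many elements.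
\<close>

text \<open>The identities concern exponents l \<ge> 1 only: the zeroth power has trace 2m while
  there is no circuit of length 0, and subtracting h(0) removes exactly that term. For fixed l there
  are finitely many circuits, so the sum over cycles is never the analytic difficulty; convergence
  concerns l alone and rests on the margin \<open>\<epsilon>\<close> beyond the spectral radius.

  The spectral sum is a function of a form, whereas (b) and (d) integrate or sum over classes.
  Equivalent forms may have different edge matrices, so invariance is read off from the circuit
  series, in which characters are evaluated at cycles only.

  The volume is defined through an arbitrarily chosen fundamental domain, known only by its defining
  property. Comparing any two domains is therefore the central measure step: against a bounded one
  it gives finiteness, against a translate of the chosen one it gives invariance. Connectedness
  enters where a form vanishing on all cycles must be exact, which makes the dual lattice
  discrete.\<close>

no_notation fps_nth (infixl \<open>$\<close> 75)

section \<open>Traces of matrix powers\<close>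

lemma mult_mat_entry:
  assumes "A \<in> carrier_mat n k" "B \<in> carrier_mat k m" "i < n" "j < m"
  shows "(A * B) $$ (i,j) = (\<Sum>l<k. A $$ (i,l) * B $$ (l,j))"
  using assms by (auto simp: scalar_prod_def atLeast0LessThan intro!: sum.cong)

text \<open>Cyclic invariance of the trace; it will remove the conjugating matrices of the Schur
  form.\<close>

lemma sum_diag_mult_comm:
  fixes A B :: "'a::comm_semiring_0 mat"
  assumes "A \<in> carrier_mat n k" "B \<in> carrier_mat k n"
  shows "(\<Sum>i<n. (A * B) $$ (i,i)) = (\<Sum>i<k. (B * A) $$ (i,i))"
proof -
  have "(\<Sum>i<n. (A * B) $$ (i,i)) = (\<Sum>i<n. \<Sum>j<k. A $$ (i,j) * B $$ (j,i))"
    using assms by (intro sum.cong) (auto simp: mult_mat_entry simp del: index_mult_mat)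
  also have "\<dots> = (\<Sum>j<k. \<Sum>i<n. B $$ (j,i) * A $$ (i,j))"
    by (subst sum.swap) (simp add: mult.commute)
  also have "\<dots> = (\<Sum>i<k. (B * A) $$ (i,i))"
    using assms by (intro sum.cong) (auto simp: mult_mat_entry simp del: index_mult_mat)
  finally show ?thesis .
qed

text \<open>A term of the product through the index l vanishes for l < i by the left factor and for
  l > j by the right one, so on the diagonal only l = i survives.\<close>

lemma upper_triangular_power:
  fixes A :: "'a::semiring_1 mat"
  assumes A: "A \<in> carrier_mat n n" and ut: "upper_triangular A"
  shows "upper_triangular (A ^\<^sub>m k) \<and> (\<forall>i<n. (A ^\<^sub>m k) $$ (i,i) = (A $$ (i,i)) ^ k)"
proof (induction k)
  case 0
  then show ?case using A by (auto simp: upper_triangular_def)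
next
  case (Suc k)
  have P: "A ^\<^sub>m k \<in> carrier_mat n n" using A by simp
  have z: "(A ^\<^sub>m k) $$ (i,j) = 0" "A $$ (i,j) = 0" if "j < i" "i < n" for i j
    using Suc ut that A P by (auto simp: upper_triangular_def)
  have entry: "(A ^\<^sub>m Suc k) $$ (i,j) = (\<Sum>l<n. (A ^\<^sub>m k) $$ (i,l) * A $$ (l,j))" if "i < n" "j < n" for i j
    unfolding pow_mat.simps by (rule mult_mat_entry[OF P A that])
  have low: "(A ^\<^sub>m Suc k) $$ (i,j) = 0" if "j < i" "i < n" for i j
  proof -
    have "(A ^\<^sub>m k) $$ (i,l) * A $$ (l,j) = 0" if "l < n" for l
      using z[of l i] z[of j l] that \<open>j < i\<close> \<open>i < n\<close> by (cases "l < i") auto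
    thus ?thesis using entry[of i j] that by simp
  qed
  have diag: "(A ^\<^sub>m Suc k) $$ (i,i) = (A $$ (i,i)) ^ Suc k" if "i < n" for i
  proof -
    have "(A ^\<^sub>m k) $$ (i,l) * A $$ (l,i) = 0" if "l < n" "l \<noteq> i" for l
      using z[of l i] z[of i l] that \<open>i < n\<close> by (cases "l < i") auto
    hence "(\<Sum>l<n. (A ^\<^sub>m k) $$ (i,l) * A $$ (l,i)) = (\<Sum>l\<in>{i}. (A ^\<^sub>m k) $$ (i,l) * A $$ (l,i))"
      using that by (intro sum.mono_neutral_right) auto
    thus ?thesis using entry[of i i] that Suc by (simp add: power_commutes)
  qed
  show ?case using low diag A by (auto simp: upper_triangular_def)
qed

text \<open>The diagonal of a complex Schur form lists the roots of the characteristic polynomial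
  with algebraic multiplicity, which is the multiplicity in \<open>spec\<close>; this covers
  non-diagonalizable edge matrices as well.\<close>

lemma spec_power_sum:
  fixes A :: "complex mat"
  assumes A: "A \<in> carrier_mat n n"
  shows "(\<Sum>z\<in>#spec A. z ^ k) = (\<Sum>i<n. (A ^\<^sub>m k) $$ (i,i))"
proof -
  obtain zs where zs: "char_poly A = (\<Prod>a\<leftarrow>zs. [:- a, 1:])"
    using char_poly_factorized[OF A] by auto
  obtain B P Q where s: "schur_decomposition A zs = (B,P,Q)"
    by (cases "schur_decomposition A zs") auto
  from schur_decomposition[OF A zs s]
  have sim: "similar_mat_wit A B P Q" and ut: "upper_triangular B" and diag: "diag_mat B = zs" by auto
  from similar_mat_witD2[OF A sim]
  have QP: "Q * P = 1\<^sub>m n" and c: "B \<in> carrier_mat n n" "P \<in> carrier_mat n n" "Q \<in> carrier_mat n n"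
    by auto
  have "proots (char_poly A) = mset zs"
  proof -
    have "proots (\<Prod>a\<leftarrow>zs. [:- a, 1:]) = mset zs"
    proof (induction zs)
      case (Cons a zs)
      have "(\<Prod>a\<leftarrow>zs. [:- a, 1:]) \<noteq> 0" by (auto simp: prod_list_zero_iff)
      thus ?case using Cons proots_mult[of "[:- a, 1:]" "\<Prod>a\<leftarrow>zs. [:- a, 1:]"] by simp
    qed simp
    thus ?thesis using zs by simp
  qed
  hence "(\<Sum>z\<in>#spec A. z ^ k) = (\<Sum>z\<leftarrow>zs. z ^ k)"
    unfolding spec_def by (metis mset_map sum_mset_sum_list)
  also have "\<dots> = (\<Sum>i<n. (B $$ (i,i)) ^ k)"
    unfolding diag[symmetric] diag_mat_def using c
    by (simp add: sum_list_sum_nth atLeast0LessThan)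
  also have "\<dots> = (\<Sum>i<n. (B ^\<^sub>m k) $$ (i,i))"
    using upper_triangular_power[OF c(1) ut] by (intro sum.cong) auto
  \<comment> \<open>Inserting \<open>Q * P\<close> lets cyclicity of the trace turn the product into
    a conjugate of the power, which is the power of \<open>A\<close>.\<close>
  also have "B ^\<^sub>m k = Q * (P * B ^\<^sub>m k)"
    using c QP by (simp flip: assoc_mult_mat[of Q n n P n "B ^\<^sub>m k" n])
  also have "(\<Sum>i<n. (Q * (P * B ^\<^sub>m k)) $$ (i,i)) = (\<Sum>i<n. ((P * B ^\<^sub>m k) * Q) $$ (i,i))"
    using c by (intro sum_diag_mult_comm) auto
  also have "(P * B ^\<^sub>m k) * Q = A ^\<^sub>m k" using similar_mat_wit_pow_id[OF sim] by simp
  finally show ?thesis .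
qed

text \<open>A root of the characteristic polynomial makes the spectrum nonempty, so
  \<open>rho\<close> is the genuine spectral radius here and not its default 0.\<close>

lemma norm_spec_le_rho:
  assumes A: "A \<in> carrier_mat n n" and z: "z \<in># spec A"
  shows "norm z \<le> rho A"
proof -
  have "char_poly A \<noteq> 0" using degree_monic_char_poly[OF A] by auto
  hence "z \<in> spectrum A"
    using z unfolding spec_def spectrum_def by (simp add: eigenvalue_root_char_poly[OF A])
  moreover from this have "n > 0"
    using eigenvalue_imp_nonzero_dim[OF A] unfolding spectrum_def by auto
  ultimately show ?thesis
    using spectral_radius_mem_max(2)[OF A, of "norm z"] by (auto simp: rho_def)
qed

section \<open>Taylor coefficients as contour integrals\<close>

lemma disk_eq_UN_ball:
  "disk G es S \<epsilon> = (\<Union>\<omega>\<in>S. ball 0 (rho (W1 G es \<omega>) + \<epsilon>))"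
  by (auto simp: disk_def)

text \<open>The larger of the two balls around the endpoints contains both. Arguing on the union
  itself avoids the supremum of the radii, which need not be attained.\<close>

lemma convex_UN_concentric_balls:
  fixes c :: "'a::real_normed_vector"
  shows "convex (\<Union>i\<in>I. ball c (r i))"
  unfolding convex_contains_segment
proof (intro ballI)
  fix x y assume "x \<in> (\<Union>i\<in>I. ball c (r i))" "y \<in> (\<Union>i\<in>I. ball c (r i))"
  then obtain i j where ij: "i \<in> I" "j \<in> I" "x \<in> ball c (r i)" "y \<in> ball c (r j)" by auto
  define k where "k = (if r i \<le> r j then j else i)"
  have "k \<in> I" "x \<in> ball c (r k)" "y \<in> ball c (r k)" using ij by (auto simp: k_def)
  thus "closed_segment x y \<subseteq> (\<Union>i\<in>I. ball c (r i))"
    using convex_ball[of c "r k"] unfolding convex_contains_segment by blast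
qed

lemma open_disk: "open (disk G es S \<epsilon>)" and convex_disk: "convex (disk G es S \<epsilon>)"
  unfolding disk_eq_UN_ball by (auto intro: convex_UN_concentric_balls)

text \<open>The residue theorem at 0, around which the loop winds once; convexity of the disk
  ensures that the loop winds around no point outside it. Hence the coefficient does not depend on
  the loop.\<close>

lemma coef_eq_Taylor:
  assumes tf: "test_function G es S \<epsilon> h \<gamma>" and 0: "0 \<in> disk G es S \<epsilon>"
  shows "coef h \<gamma> l = (deriv ^^ l) h 0 / fact l"
proof -
  let ?D = "disk G es S \<epsilon>"
  have h: "h holomorphic_on ?D" using tf open_disk[of G es S \<epsilon>]
    by (simp add: test_function_def analytic_on_open)
  have g: "valid_path \<gamma>" "pathfinish \<gamma> = pathstart \<gamma>" "path_image \<gamma> \<subseteq> ?D - {0}"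
      "winding_number \<gamma> 0 = 1"
    using tf by (auto simp: test_function_def ccw_loop_in_def)
  have eq: "h z * z powi (- int l - 1) = h z / z ^ Suc l" for z
  proof -
    have "- int l - 1 = - int (Suc l)" by simp
    thus ?thesis by (simp only: power_int_minus power_int_of_nat divide_inverse)
  qed
  have wn: "winding_number \<gamma> z = 0" if "z \<notin> ?D" for z
    using winding_number_zero_outside[of \<gamma> ?D z] g that convex_disk valid_path_imp_path by blast
  have "contour_integral \<gamma> (\<lambda>z. h z / z ^ Suc l)
      = 2 * pi * \<i> * (\<Sum>p\<in>{0}. winding_number \<gamma> p * residue (\<lambda>z. h z / z ^ Suc l) p)"
    by (rule Residue_theorem[OF open_disk[of G es S \<epsilon>] convex_connected[OF convex_disk[of G es S \<epsilon>]]])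
       (use g wn in \<open>auto intro!: holomorphic_intros holomorphic_on_subset[OF h]\<close>)
  moreover have "residue (\<lambda>z. h z / z ^ Suc l) 0 = (deriv ^^ l) h 0 / fact l"
    by (rule residue_holomorphic_over_power'[OF open_disk 0 h])
  ultimately show ?thesis unfolding coef_def eq using g(4) by simp
qed

text \<open>Eigenvalues lie in the closed disk of radius \<open>rho\<close>, and
  \<open>\<epsilon>\<close> leaves room for a larger disk of convergence. The series starts at
  \<open>Suc l\<close> because the constant term is \<open>h 0\<close>.\<close>

lemma coef_sums:
  assumes tf: "test_function G es S \<epsilon> h \<gamma>" and \<omega>: "\<omega> \<in> S"
    and z: "norm z \<le> rho (W1 G es \<omega>)"
  shows "(\<lambda>l. coef h \<gamma> (Suc l) * z ^ Suc l) sums (h z - h 0)"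
    and "summable (\<lambda>l. norm (coef h \<gamma> (Suc l)) * norm z ^ Suc l)"
proof -
  let ?r = "rho (W1 G es \<omega>)"
  have e: "\<epsilon> > 0" and h: "h analytic_on disk G es S \<epsilon>" using tf by (auto simp: test_function_def)
  have sub: "ball 0 (?r + \<epsilon>) \<subseteq> disk G es S \<epsilon>" using \<omega> by (auto simp: disk_eq_UN_ball)
  have hol: "h holomorphic_on ball 0 (?r + \<epsilon>)"
    using analytic_on_subset[OF h sub] by (rule analytic_imp_holomorphic)
  have r: "0 \<le> ?r" using z norm_ge_zero order_trans by blast
  have "0 \<in> disk G es S \<epsilon>" using r e by (intro subsetD[OF sub]) auto
  note coef = coef_eq_Taylor[OF tf this]
  have sums: "(\<lambda>l. coef h \<gamma> l * w ^ l) sums h w" if "w \<in> ball 0 (?r + \<epsilon>)" for w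
    using holomorphic_power_series[OF hol that] by (simp add: coef)
  have "coef h \<gamma> 0 = h 0" by (simp add: coef)
  moreover have "(\<lambda>l. coef h \<gamma> l * z ^ l) sums h z" using sums[of z] z e by simp
  ultimately show "(\<lambda>l. coef h \<gamma> (Suc l) * z ^ Suc l) sums (h z - h 0)"
    using sums_Suc_iff[of "\<lambda>l. coef h \<gamma> l * z ^ l" "h z - h 0"] by simp
  \<comment> \<open>A point of modulus strictly between \<open>?r\<close> and
    \<open>?r + \<epsilon>\<close>: convergence there forces absolute convergence at the smaller
    modulus of \<open>z\<close>.\<close>
  define x :: complex where "x = of_real (?r + \<epsilon> / 2)"
  have nx: "norm x = ?r + \<epsilon> / 2" unfolding x_def using r e by (simp del: of_real_add of_real_divide)
  have "summable (\<lambda>l. coef h \<gamma> l * x ^ l)"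
    using sums[of x] nx e by (auto simp: dist_norm sums_iff)
  hence "summable (\<lambda>l. norm (coef h \<gamma> l * z ^ l))"
    by (rule powser_insidea) (use z nx e in auto)
  thus "summable (\<lambda>l. norm (coef h \<gamma> (Suc l)) * norm z ^ Suc l)"
    using summable_Suc_iff[of "\<lambda>l. norm (coef h \<gamma> l * z ^ l)"] by (simp only: norm_mult norm_power)
qed

section \<open>Traces and circuits\<close>

lemma finite_oriented_edges [simp]: "finite (oriented_edges (G :: ('v,'e::finite) pre_digraph))"
  by (simp add: oriented_edges_def)

lemma inv_edge_inv_edge [simp]: "inv_edge (inv_edge a) = a"
  by (simp add: inv_edge_def)

definition circuits :: "('v,'e::finite) pre_digraph \<Rightarrow> nat \<Rightarrow> 'e oedge list set" where
  "circuits G l = {c. is_circuit G c \<and> length c = l}"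

lemma finite_circuits [simp]: "finite (circuits G l)"
proof (rule finite_subset)
  show "circuits G l \<subseteq> {c. set c \<subseteq> oriented_edges G \<and> length c = l}"
    by (auto simp: circuits_def is_circuit_def is_walk_def)
qed (rule finite_lists_length_eq[OF finite_oriented_edges])

text \<open>Repeating the first edge at the end makes closing up and having no tail one more
  instance of \<open>feeds_into\<close>; the two ways of excluding a tail agree because inversion is
  an involution.\<close>

lemma is_circuit_Cons_iff:
  "is_circuit G (a # c) \<longleftrightarrow>
     set (a # c) \<subseteq> oriented_edges G \<and> successively (feeds_into G) (a # c @ [a])"
proof -
  have "successively (feeds_into G) (a # c @ [a]) \<longleftrightarrow>
      successively (feeds_into G) (a # c) \<and> feeds_into G (last (a # c)) a"
    using successively_append_iff[of "feeds_into G" "a # c" "[a]"] by simp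
  moreover have "feeds_into G (last (a # c)) a \<longleftrightarrow>
      terminal_vertex G (last (a # c)) = initial_vertex G a \<and> last (a # c) \<noteq> inv_edge a"
    unfolding feeds_into_def by (metis inv_edge_inv_edge)
  ultimately show ?thesis
    unfolding is_circuit_def is_walk_def successively_conv_nth feeds_into_def by auto
qed

definition edge_wt :: "('v,'e::finite) pre_digraph \<Rightarrow> real ^ 'e \<Rightarrow> 'e oedge \<Rightarrow> 'e oedge \<Rightarrow> complex" where
  "edge_wt G \<omega> a b = (if feeds_into G a b then chr \<omega> (edge_chain b) else 0)"

text \<open>The product of matrix entries along a sequence of edges. Each step contributes the
  character of the edge it enters, so the first edge carries no weight; on a closed sequence, whose
  last edge repeats the first, every edge of the circuit then counts exactly once.\<close>

fun walk_wt :: "('v,'e::finite) pre_digraph \<Rightarrow> real ^ 'e \<Rightarrow> 'e oedge list \<Rightarrow> complex" where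
  "walk_wt G \<omega> (a # b # c) = edge_wt G \<omega> a b * walk_wt G \<omega> (b # c)"
| "walk_wt G \<omega> c = 1"

text \<open>The recursion peels off the first edge, while multiplying a power by the matrix on the
  right appends a last one.\<close>

lemma walk_wt_snoc: "walk_wt G \<omega> (c @ [a, b]) = walk_wt G \<omega> (c @ [a]) * edge_wt G \<omega> a b"
proof (induction c)
  case (Cons d c)
  thus ?case by (cases c) auto
qed simp

section \<open>Algebra of characters\<close>

lemma chr_add: "chr \<omega> (\<alpha> + \<beta>) = chr \<omega> \<alpha> * chr \<omega> \<beta>"
  by (simp add: chr_def inner_add_right exp_add ring_distribs)

lemma chr_add_left: "chr (\<omega> + \<eta>) \<alpha> = chr \<omega> \<alpha> * chr \<eta> \<alpha>"
  by (simp add: chr_def inner_add_left exp_add ring_distribs)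

lemma chr_0_right [simp]: "chr \<omega> 0 = 1" and chr_0_left [simp]: "chr 0 \<alpha> = 1"
  by (simp_all add: chr_def)

lemma chr_minus_minus: "chr (-\<omega>) \<alpha> = chr \<omega> (-\<alpha>)"
  by (simp add: chr_def)

lemma chr_eq_cis: "chr \<omega> \<alpha> = cis (2 * pi * (\<omega> \<bullet> \<alpha>))"
  by (simp add: chr_def cis_conv_exp mult_ac)

lemma norm_chr [simp]: "norm (chr \<omega> \<alpha>) = 1"
  by (simp add: chr_eq_cis)

lemma chr_nonzero [simp]: "chr \<omega> \<alpha> \<noteq> 0"
  by (simp add: chr_def)

lemma chr_eq_1_iff: "chr \<omega> \<alpha> = 1 \<longleftrightarrow> \<omega> \<bullet> \<alpha> \<in> \<int>"
proof -
  have "chr \<omega> \<alpha> = 1 \<longleftrightarrow> (\<exists>n::int. 2 * pi * (\<omega> \<bullet> \<alpha>) = of_int (2 * n) * pi)"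
    unfolding chr_def exp_eq_1 by (auto simp: mult_ac)
  also have "\<dots> \<longleftrightarrow> (\<exists>n::int. \<omega> \<bullet> \<alpha> = of_int n)"
    by (intro ex_cong1) (auto simp: field_simps)
  finally show ?thesis by (auto simp: Ints_def)
qed

lemma abelianization_simps [simp]:
  "abelianization [] = 0"
  "abelianization (a # c) = edge_chain a + abelianization c"
  "abelianization (c @ d) = abelianization c + abelianization d"
  by (simp_all add: abelianization_def)

lemma walk_wt_Cons:
  "walk_wt G \<omega> (a # c) =
     (if successively (feeds_into G) (a # c) then chr \<omega> (abelianization c) else 0)"
  by (induction c arbitrary: a) (auto simp: edge_wt_def chr_add)

lemma length_oriented_list [simp]: "length (oriented_list es) = 2 * length es"
  by (simp add: oriented_list_def)

lemma set_oriented_list: "set (oriented_list es) = set es \<times> UNIV"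
  by (auto simp: oriented_list_def)

lemma distinct_oriented_list: "distinct es \<Longrightarrow> distinct (oriented_list es)"
  by (auto simp: oriented_list_def distinct_map inj_on_def)

lemma sum_oriented_list:
  assumes "distinct es" "set es = arcs G"
  shows "(\<Sum>i<2 * length es. f (oriented_list es ! i)) = (\<Sum>a\<in>oriented_edges G. f a)"
  using bij_betw_nth[OF distinct_oriented_list[OF assms(1)], of "{..<2 * length es}" "oriented_edges G"]
    assms(2) by (intro sum.reindex_bij_betw) (auto simp: set_oriented_list oriented_edges_def)

lemma W1_carrier [simp]: "W1 G es \<omega> \<in> carrier_mat (2 * length es) (2 * length es)"
  by (simp add: W1_def)

lemma W1_entry:
  "i < 2 * length es \<Longrightarrow> j < 2 * length es \<Longrightarrow>
     W1 G es \<omega> $$ (i, j) = edge_wt G \<omega> (oriented_list es ! i) (oriented_list es ! j)"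
  by (simp add: W1_def edge_wt_def)

lemma sum_lists_snoc:
  assumes "finite A"
  shows "(\<Sum>c | set c \<subseteq> A \<and> length c = Suc k. f c)
       = (\<Sum>a\<in>A. \<Sum>c | set c \<subseteq> A \<and> length c = k. f (c @ [a]))"
proof -
  have "(\<Sum>a\<in>A. \<Sum>c | set c \<subseteq> A \<and> length c = k. f (c @ [a])) =
      (\<Sum>(a,c)\<in>A \<times> {c. set c \<subseteq> A \<and> length c = k}. f (c @ [a]))"
    by (rule sum.cartesian_product)
  also have "\<dots> = (\<Sum>c | set c \<subseteq> A \<and> length c = Suc k. f c)"
    by (rule sum.reindex_bij_witness[of _ "\<lambda>c. (last c, butlast c)" "\<lambda>(a,c). c @ [a]"])
       (auto dest: in_set_butlastD last_in_set
          simp flip: length_greater_0_conv)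
  finally show ?thesis ..
qed

text \<open>\<open>k\<close> counts the intermediate edges between the two given ones, which is why
  the exponent is \<open>Suc k\<close>.\<close>

lemma W1_power_entry:
  fixes G :: "('v,'e::finite) pre_digraph"
  assumes es: "distinct es" "set es = arcs G"
    and i: "i < 2 * length es" and j: "j < 2 * length es"
  shows "(W1 G es \<omega> ^\<^sub>m Suc k) $$ (i, j) =
     (\<Sum>c | set c \<subseteq> oriented_edges G \<and> length c = k.
        walk_wt G \<omega> (oriented_list es ! i # c @ [oriented_list es ! j]))"
  using j
proof (induction k arbitrary: j)
  case 0
  have "{c. set c \<subseteq> oriented_edges G \<and> length c = 0} = {[]}" by auto
  with 0 i show ?case by (simp add: W1_entry)
next
  case (Suc k)
  let ?n = "2 * length es" and ?W = "W1 G es \<omega>" and ?a = "\<lambda>i. oriented_list es ! i"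
  let ?L = "{c. set c \<subseteq> oriented_edges G \<and> length c = k}"
  have c: "?W ^\<^sub>m Suc k \<in> carrier_mat ?n ?n" by (intro pow_carrier_mat) simp
  have "(?W ^\<^sub>m Suc (Suc k)) $$ (i,j) = (\<Sum>l<?n. (?W ^\<^sub>m Suc k) $$ (i,l) * ?W $$ (l,j))"
    unfolding pow_mat.simps(2)[of _ "Suc k"]
    by (rule mult_mat_entry[OF c W1_carrier i Suc.prems])
  also have "\<dots> = (\<Sum>l<?n. (\<Sum>c\<in>?L. walk_wt G \<omega> (?a i # c @ [?a l])) * edge_wt G \<omega> (?a l) (?a j))"
    using Suc.prems by (intro sum.cong) (auto simp: Suc.IH W1_entry simp del: pow_mat.simps)
  also have "\<dots> = (\<Sum>b\<in>oriented_edges G.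
      (\<Sum>c\<in>?L. walk_wt G \<omega> (?a i # c @ [b])) * edge_wt G \<omega> b (?a j))"
    by (rule sum_oriented_list[OF es])
  also have "\<dots> = (\<Sum>b\<in>oriented_edges G. \<Sum>c\<in>?L. walk_wt G \<omega> (?a i # (c @ [b]) @ [?a j]))"
    using walk_wt_snoc[of G \<omega> "?a i # _"] by (simp add: sum_distrib_right)
  also have "\<dots> = (\<Sum>c | set c \<subseteq> oriented_edges G \<and> length c = Suc k. walk_wt G \<omega> (?a i # c @ [?a j]))"
    by (rule sum_lists_snoc[symmetric]) simp
  finally show ?case .
qed

text \<open>A diagonal entry fixes the first edge of a circuit. Circuits are lists with a first
  edge, so the trace meets each exactly once and no rotations are identified.\<close>

lemma trace_W1_power:
  fixes G :: "('v,'e::finite) pre_digraph"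
  assumes es: "distinct es" "set es = arcs G"
  shows "(\<Sum>z\<in>#spec (W1 G es \<omega>). z ^ Suc k) = (\<Sum>c\<in>circuits G (Suc k). chr \<omega> (abelianization c))"
proof -
  let ?E = "oriented_edges G" and ?L = "{c. set c \<subseteq> oriented_edges G \<and> length c = k}"
  have "(\<Sum>z\<in>#spec (W1 G es \<omega>). z ^ Suc k) =
      (\<Sum>i<2 * length es. \<Sum>c\<in>?L. walk_wt G \<omega> (oriented_list es ! i # c @ [oriented_list es ! i]))"
    unfolding spec_power_sum[OF W1_carrier] using W1_power_entry[OF es]
    by (intro sum.cong) (auto simp del: pow_mat.simps)
  also have "\<dots> = (\<Sum>a\<in>?E. \<Sum>c\<in>?L. walk_wt G \<omega> (a # c @ [a]))"
    by (rule sum_oriented_list[OF es])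
  also have "\<dots> = (\<Sum>(a,c)\<in>?E \<times> ?L. walk_wt G \<omega> (a # c @ [a]))"
    by (rule sum.cartesian_product)
  \<comment> \<open>The weight is the character of \<open>c @ [a]\<close>, and abelianization does
    not see the cyclic shift to \<open>a # c\<close>.\<close>
  also have "\<dots> = (\<Sum>(a,c)\<in>?E \<times> ?L. if is_circuit G (a # c) then chr \<omega> (abelianization (a # c)) else 0)"
    by (intro sum.cong) (auto simp: walk_wt_Cons is_circuit_Cons_iff add_ac)
  also have "\<dots> = (\<Sum>c | set c \<subseteq> ?E \<and> length c = Suc k. if is_circuit G c then chr \<omega> (abelianization c) else 0)"
    by (rule sum.reindex_bij_witness[of _ "\<lambda>c. (hd c, tl c)" "\<lambda>(a,c). a # c"])
       (auto simp: length_Suc_conv)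
  also have "\<dots> = (\<Sum>c\<in>circuits G (Suc k). chr \<omega> (abelianization c))"
    by (rule sum.mono_neutral_cong_right)
       (auto simp: circuits_def is_circuit_def is_walk_def intro: finite_lists_length_eq)
  finally show ?thesis .
qed

section \<open>Cycles and harmonic forms\<close>

text \<open>The cycle condition and harmonicity both say that this vanishes at every vertex, so in
  coordinates \<open>H1 G\<close> consists of the integral points of
  \<open>harmonic_forms G\<close>.\<close>

definition boundary :: "('v,'e::finite) pre_digraph \<Rightarrow> real ^ 'e \<Rightarrow> 'v \<Rightarrow> real" where
  "boundary G \<alpha> v = (\<Sum>e | e \<in> arcs G \<and> head G e = v. \<alpha> $ e)
                  - (\<Sum>e | e \<in> arcs G \<and> tail G e = v. \<alpha> $ e)"

lemma boundary_add: "boundary G (\<alpha> + \<beta>) v = boundary G \<alpha> v + boundary G \<beta> v"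
  and boundary_diff: "boundary G (\<alpha> - \<beta>) v = boundary G \<alpha> v - boundary G \<beta> v"
  and boundary_scaleR: "boundary G (c *\<^sub>R \<alpha>) v = c * boundary G \<alpha> v"
  and boundary_0: "boundary G 0 v = 0"
  by (simp_all add: boundary_def sum.distrib sum_subtractf sum_distrib_left right_diff_distrib)

lemma boundary_edge_chain:
  assumes "a \<in> oriented_edges G"
  shows "boundary G (edge_chain a) v =
    of_bool (terminal_vertex G a = v) - of_bool (initial_vertex G a = v)"
proof -
  obtain e s where a: "a = (e, s)" by (cases a)
  have e: "e \<in> arcs G" using assms a by (auto simp: oriented_edges_def)
  have *: "(\<Sum>e' | e' \<in> arcs G \<and> p e' = v. axis e (1::real) $ e') = of_bool (p e = v)" for p
  proof -
    have "(\<Sum>e' | e' \<in> arcs G \<and> p e' = v. axis e (1::real) $ e') =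
        (\<Sum>e' | e' \<in> arcs G \<and> p e' = v. if e' = e then 1 else 0)"
      by (intro sum.cong) (auto simp: axis_def)
    also have "\<dots> = of_bool (p e = v)" using e by (subst sum.delta) auto
    finally show ?thesis .
  qed
  show ?thesis
    using * by (simp add: boundary_def edge_chain_def a initial_vertex_def terminal_vertex_def sum_negf)
qed

lemma H1_eq: "H1 G = {\<alpha> \<in> chains G. (\<forall>e. \<alpha> $ e \<in> \<int>) \<and> (\<forall>v\<in>verts G. boundary G \<alpha> v = 0)}"
  by (simp add: H1_def boundary_def)

lemma harmonic_forms_eq: "harmonic_forms G = {\<omega> \<in> one_forms G. \<forall>v\<in>verts G. boundary G \<omega> v = 0}"
  by (simp add: harmonic_forms_def boundary_def)

lemma one_forms_eq_chains: "one_forms G = chains G"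
  by (simp add: one_forms_def chains_def)

lemma chains_closed:
  "0 \<in> chains G" "\<alpha> \<in> chains G \<Longrightarrow> \<beta> \<in> chains G \<Longrightarrow> \<alpha> + \<beta> \<in> chains G"
  "\<alpha> \<in> chains G \<Longrightarrow> \<beta> \<in> chains G \<Longrightarrow> \<alpha> - \<beta> \<in> chains G"
  "\<alpha> \<in> chains G \<Longrightarrow> c *\<^sub>R \<alpha> \<in> chains G"
  by (auto simp: chains_def)

lemma H1_closed:
  "0 \<in> H1 G" "\<alpha> \<in> H1 G \<Longrightarrow> \<beta> \<in> H1 G \<Longrightarrow> \<alpha> + \<beta> \<in> H1 G"
  "\<alpha> \<in> H1 G \<Longrightarrow> \<beta> \<in> H1 G \<Longrightarrow> \<alpha> - \<beta> \<in> H1 G"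
  by (auto simp: H1_eq chains_closed boundary_add boundary_diff boundary_0)

lemma H1_subset_harmonic: "H1 G \<subseteq> harmonic_forms G"
  by (auto simp: H1_eq harmonic_forms_eq one_forms_eq_chains)

lemma subspace_one_forms: "Real_Vector_Spaces.subspace (one_forms G)"
  by (auto simp: Real_Vector_Spaces.subspace_def one_forms_eq_chains chains_closed)

lemma subspace_harmonic: "Real_Vector_Spaces.subspace (harmonic_forms G)"
  by (auto simp: Real_Vector_Spaces.subspace_def harmonic_forms_eq one_forms_eq_chains chains_closed
      boundary_add boundary_scaleR boundary_0)

lemma harmonic_subset: "harmonic_forms G \<subseteq> one_forms G"
  by (auto simp: harmonic_forms_def)

lemma subspace_exact: "Real_Vector_Spaces.subspace (exact_forms G)"
  unfolding Real_Vector_Spaces.subspace_def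
proof (intro conjI ballI allI)
  show "0 \<in> exact_forms G"
    by (auto simp: exact_forms_def one_forms_def intro!: exI[of _ "\<lambda>_. 0"])
next
  fix x y assume "x \<in> exact_forms G" "y \<in> exact_forms G"
  then obtain f g where "x \<in> one_forms G" "y \<in> one_forms G"
    "\<forall>e\<in>arcs G. x $ e = f (head G e) - f (tail G e)" "\<forall>e\<in>arcs G. y $ e = g (head G e) - g (tail G e)"
    unfolding exact_forms_def by blast
  thus "x + y \<in> exact_forms G"
    by (auto simp: exact_forms_def one_forms_def intro!: exI[of _ "\<lambda>v. f v + g v"])
next
  fix x c assume "x \<in> exact_forms G"
  then obtain f where "x \<in> one_forms G" "\<forall>e\<in>arcs G. x $ e = f (head G e) - f (tail G e)"
    unfolding exact_forms_def by blast
  thus "c *\<^sub>R x \<in> exact_forms G"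
    by (auto simp: exact_forms_def one_forms_def right_diff_distrib intro!: exI[of _ "\<lambda>v. c * f v"])
qed

section \<open>Orthogonal decomposition into harmonic and exact forms\<close>

context
  fixes G :: "('v,'e::finite) pre_digraph"
  assumes G: "fin_digraph G"
begin

text \<open>Summation by parts: the gradient is adjoint to the boundary, as grouping the arcs by
  head and by tail shows.\<close>

lemma inner_gradient:
  assumes "\<alpha> \<in> chains G" and f: "\<forall>e\<in>arcs G. \<omega> $ e = f (head G e) - f (tail G e)"
  shows "\<alpha> \<bullet> \<omega> = (\<Sum>v\<in>verts G. f v * boundary G \<alpha> v)"
proof -
  interpret fin_digraph G by fact
  have *: "(\<Sum>e\<in>arcs G. f (p e) * \<alpha> $ e) = (\<Sum>v\<in>verts G. f v * (\<Sum>e | e \<in> arcs G \<and> p e = v. \<alpha> $ e))"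
    if "p ` arcs G \<subseteq> verts G" for p
  proof -
    have "(\<Sum>v\<in>verts G. f v * (\<Sum>e | e \<in> arcs G \<and> p e = v. \<alpha> $ e)) =
        (\<Sum>v\<in>verts G. \<Sum>e | e \<in> arcs G \<and> p e = v. f (p e) * \<alpha> $ e)"
      by (simp add: sum_distrib_left)
    also have "\<dots> = (\<Sum>e\<in>arcs G. f (p e) * \<alpha> $ e)"
      using that by (intro sum.group) auto
    finally show ?thesis ..
  qed
  have "\<alpha> \<bullet> \<omega> = (\<Sum>e\<in>UNIV. \<alpha> $ e * \<omega> $ e)" by (simp add: inner_vec_def)
  also have "\<dots> = (\<Sum>e\<in>arcs G. \<alpha> $ e * \<omega> $ e)"
    using assms(1) by (intro sum.mono_neutral_right) (auto simp: chains_def)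
  also have "\<dots> = (\<Sum>e\<in>arcs G. f (head G e) * \<alpha> $ e) - (\<Sum>e\<in>arcs G. f (tail G e) * \<alpha> $ e)"
    unfolding sum_subtractf[symmetric] using f by (intro sum.cong) (auto simp: right_diff_distrib mult.commute)
  also have "\<dots> = (\<Sum>v\<in>verts G. f v * boundary G \<alpha> v)"
    by (subst (1 2) *) (auto simp: boundary_def right_diff_distrib sum_subtractf)
  finally show ?thesis .
qed

lemma harmonic_orthogonal_exact:
  "\<alpha> \<in> harmonic_forms G \<Longrightarrow> \<omega> \<in> exact_forms G \<Longrightarrow> \<alpha> \<bullet> \<omega> = 0"
  using inner_gradient[of \<alpha> \<omega>]
  by (fastforce simp: exact_forms_def harmonic_forms_eq one_forms_eq_chains)

lemma orthogonal_exact_imp_harmonic: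
  assumes \<alpha>: "\<alpha> \<in> one_forms G" and orth: "\<And>\<omega>. \<omega> \<in> exact_forms G \<Longrightarrow> \<alpha> \<bullet> \<omega> = 0"
  shows "\<alpha> \<in> harmonic_forms G"
proof -
  interpret fin_digraph G by fact
  have "boundary G \<alpha> v = 0" if v: "v \<in> verts G" for v
  proof -
    \<comment> \<open>The gradient of a vertex indicator tests the boundary at that one
      vertex.\<close>
    define f :: "'v \<Rightarrow> real" where "f = (\<lambda>u. of_bool (u = v))"
    define \<omega> :: "real ^ 'e" where "\<omega> = (\<chi> e. if e \<in> arcs G then f (head G e) - f (tail G e) else 0)"
    have "\<omega> \<in> exact_forms G"
      unfolding exact_forms_def one_forms_def by (auto simp: \<omega>_def)
    hence "0 = \<alpha> \<bullet> \<omega>" using orth by simp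
    also have "\<dots> = (\<Sum>u\<in>verts G. f u * boundary G \<alpha> u)"
      using \<alpha> by (intro inner_gradient) (auto simp: one_forms_eq_chains \<omega>_def)
    also have "\<dots> = (\<Sum>u\<in>verts G. if u = v then boundary G \<alpha> u else 0)"
      by (intro sum.cong) (auto simp: f_def)
    also have "\<dots> = boundary G \<alpha> v" using v by simp
    finally show ?thesis by simp
  qed
  thus ?thesis using \<alpha> by (simp add: harmonic_forms_eq)
qed

text \<open>Existence comes from projecting onto the exact forms; two solutions differ by a form
  that is harmonic and exact, hence orthogonal to itself. This justifies the definite description in
  \<open>harmonic_part\<close>.\<close>

lemma harmonic_part:
  assumes "\<omega> \<in> one_forms G"
  shows "harmonic_part G \<omega> \<in> harmonic_forms G" "\<omega> - harmonic_part G \<omega> \<in> exact_forms G"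
proof -
  have "\<exists>!\<eta>. \<eta> \<in> harmonic_forms G \<and> \<omega> - \<eta> \<in> exact_forms G"
  proof (rule ex_ex1I)
    obtain x y where xy: "x \<in> span (exact_forms G)" "\<And>w. w \<in> span (exact_forms G) \<Longrightarrow> Linear_Algebra.orthogonal y w"
      "\<omega> = x + y" using orthogonal_subspace_decomp_exists[of "exact_forms G" \<omega>] by metis
    hence x: "x \<in> exact_forms G" and "\<And>w. w \<in> exact_forms G \<Longrightarrow> y \<bullet> w = 0"
      by (auto simp: span_eq_iff[THEN iffD2, OF subspace_exact] Linear_Algebra.orthogonal_def)
    moreover have "y \<in> one_forms G"
    proof -
      have "x \<in> one_forms G" using x by (auto simp: exact_forms_def)
      hence "\<omega> - x \<in> one_forms G" using assms subspace_diff[OF subspace_one_forms] by blast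
      thus ?thesis using xy(3) by simp
    qed
    ultimately show "\<exists>\<eta>. \<eta> \<in> harmonic_forms G \<and> \<omega> - \<eta> \<in> exact_forms G"
      using xy(3) by (intro exI[of _ y]) (auto intro: orthogonal_exact_imp_harmonic)
  next
    fix \<eta> \<eta>' assume *: "\<eta> \<in> harmonic_forms G \<and> \<omega> - \<eta> \<in> exact_forms G" "\<eta>' \<in> harmonic_forms G \<and> \<omega> - \<eta>' \<in> exact_forms G"
    have "\<eta> - \<eta>' \<in> harmonic_forms G" using * subspace_diff[OF subspace_harmonic] by blast
    moreover have "\<eta> - \<eta>' \<in> exact_forms G"
      using * subspace_diff[OF subspace_exact, of "\<omega> - \<eta>'" G "\<omega> - \<eta>"] by (simp add: algebra_simps)
    ultimately have "(\<eta> - \<eta>') \<bullet> (\<eta> - \<eta>') = 0" by (rule harmonic_orthogonal_exact)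
    thus "\<eta> = \<eta>'" by simp
  qed
  from theI'[OF this] show "harmonic_part G \<omega> \<in> harmonic_forms G" "\<omega> - harmonic_part G \<omega> \<in> exact_forms G"
    unfolding harmonic_part_def by auto
qed

text \<open>Evaluation on cycles does not see the exact part; this is why characters of cycles
  depend only on the class of the form.\<close>

lemma inner_harmonic_part:
  assumes "\<omega> \<in> one_forms G" "\<alpha> \<in> harmonic_forms G"
  shows "harmonic_part G \<omega> \<bullet> \<alpha> = \<omega> \<bullet> \<alpha>"
  using harmonic_orthogonal_exact[OF assms(2) harmonic_part(2)[OF assms(1)]]
  by (simp add: inner_diff_right inner_commute)

lemma harmonic_part_harmonic:
  assumes "\<omega> \<in> harmonic_forms G" shows "harmonic_part G \<omega> = \<omega>"
proof -
  let ?d = "\<omega> - harmonic_part G \<omega>"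
  have 1: "\<omega> \<in> one_forms G" using assms harmonic_subset by auto
  have "?d \<in> harmonic_forms G"
    using assms harmonic_part(1)[OF 1] subspace_diff[OF subspace_harmonic] by blast
  hence "?d \<bullet> ?d = 0" using harmonic_part(2)[OF 1] by (rule harmonic_orthogonal_exact)
  thus ?thesis by simp
qed

end

section \<open>Additive subgroups, cosets and classes of forms\<close>

lemma mem_coset_iff: "y \<in> coset L x \<longleftrightarrow> y - x \<in> L" for x :: "'a::ab_group_add"
  unfolding coset_def by (metis add_diff_cancel_left' diff_add_cancel image_iff add.commute)

definition subgrp :: "'a::ab_group_add set \<Rightarrow> bool" where
  "subgrp L \<longleftrightarrow> 0 \<in> L \<and> (\<forall>x\<in>L. \<forall>y\<in>L. x - y \<in> L)"

lemma subgrpD: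
  assumes "subgrp L"
  shows "0 \<in> L" "x \<in> L \<Longrightarrow> y \<in> L \<Longrightarrow> x - y \<in> L" "x \<in> L \<Longrightarrow> - x \<in> L" "x \<in> L \<Longrightarrow> y \<in> L \<Longrightarrow> x + y \<in> L"
proof -
  show 0: "0 \<in> L" and d: "x \<in> L \<Longrightarrow> y \<in> L \<Longrightarrow> x - y \<in> L" for x y using assms by (auto simp: subgrp_def)
  show n: "x \<in> L \<Longrightarrow> - x \<in> L" for x using d[OF 0, of x] by simp
  show "x \<in> L \<Longrightarrow> y \<in> L \<Longrightarrow> x + y \<in> L" using d[of x "-y"] n[of y] by simp
qed

lemma coset_eq_iff:
  assumes "subgrp L"
  shows "coset L x = coset L y \<longleftrightarrow> x - y \<in> L"
proof
  have "x \<in> coset L x" using subgrpD(1)[OF assms] by (simp add: mem_coset_iff)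
  moreover assume "coset L x = coset L y"
  ultimately show "x - y \<in> L" by (simp add: mem_coset_iff)
next
  assume xy: "x - y \<in> L"
  have "z - x \<in> L \<longleftrightarrow> z - y \<in> L" for z
    using subgrpD(2)[OF assms, of "z - y" "x - y"] subgrpD(4)[OF assms, of "z - x" "x - y"] xy by auto
  thus "coset L x = coset L y" by (auto simp: mem_coset_iff)
qed

lemma self_in_coset: "subgrp L \<Longrightarrow> x \<in> coset L x"
  by (simp add: mem_coset_iff subgrpD(1))

lemma subgrp_H1: "subgrp (H1 G)"
  by (simp add: subgrp_def H1_closed)

lemma subgrp_dual_lattice: "subgrp (dual_lattice G \<Lambda>)"
  using subspace_diff[OF subspace_harmonic] subspace_0[OF subspace_harmonic]
  by (auto simp: subgrp_def dual_lattice_def inner_diff_left)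

lemma finite_index_subgroupD:
  assumes "finite_index_subgroup G \<Lambda>"
  shows "subgrp \<Lambda>" "\<Lambda> \<subseteq> H1 G" "finite (quot G \<Lambda>)"
  using assms by (auto simp: finite_index_subgroup_def subgrp_def quot_def)

lemma chr_eq_iff: "chr \<omega> \<alpha> = chr \<omega>' \<alpha> \<longleftrightarrow> (\<omega> - \<omega>') \<bullet> \<alpha> \<in> \<int>"
proof -
  have "chr \<omega> \<alpha> = chr (\<omega> - \<omega>') \<alpha> * chr \<omega>' \<alpha>" using chr_add_left[of "\<omega> - \<omega>'" \<omega>' \<alpha>] by simp
  thus ?thesis using chr_eq_1_iff[of "\<omega> - \<omega>'" \<alpha>] by auto
qed

lemma form_class_chr:
  assumes G: "fin_digraph G" and o: "\<omega> \<in> one_forms G" and h: "\<eta> \<in> harmonic_forms G"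
    and eq: "form_class G \<omega> = coset (dual_lattice G (H1 G)) \<eta>" and a: "\<alpha> \<in> H1 G"
  shows "chr \<omega> \<alpha> = chr \<eta> \<alpha>"
proof -
  have "harmonic_part G \<omega> - \<eta> \<in> dual_lattice G (H1 G)"
    using eq unfolding form_class_def by (simp add: coset_eq_iff subgrp_dual_lattice)
  hence "(harmonic_part G \<omega> - \<eta>) \<bullet> \<alpha> \<in> \<int>" using a by (auto simp: dual_lattice_def)
  hence "(\<omega> - \<eta>) \<bullet> \<alpha> \<in> \<int>"
    using inner_harmonic_part[OF G o] a H1_subset_harmonic by (metis inner_diff_left subsetD)
  thus ?thesis by (simp add: chr_eq_iff)
qed

lemma form_class_harmonic:
  "fin_digraph G \<Longrightarrow> \<eta> \<in> harmonic_forms G \<Longrightarrow> form_class G \<eta> = coset (dual_lattice G (H1 G)) \<eta>"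
  by (simp add: form_class_def harmonic_part_harmonic)

section \<open>Abelianizations of circuits\<close>

lemma edge_chain_chains: "a \<in> oriented_edges G \<Longrightarrow> edge_chain a \<in> chains G"
  by (auto simp: chains_def edge_chain_def oriented_edges_def axis_def)

lemma edge_chain_Ints: "edge_chain a $ e \<in> \<int>"
  by (auto simp: edge_chain_def axis_def)

text \<open>Consecutive edges share a vertex, so the boundary telescopes; for a circuit the two
  remaining endpoints coincide.\<close>

lemma boundary_abelianization:
  assumes "set (a # c) \<subseteq> oriented_edges G" "successively (feeds_into G) (a # c)"
  shows "boundary G (abelianization (a # c)) v =
    of_bool (terminal_vertex G (last (a # c)) = v) - of_bool (initial_vertex G a = v)"
  using assms
proof (induction c arbitrary: a)
  case (Cons b c)
  thus ?case by (simp add: boundary_add boundary_edge_chain feeds_into_def)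
qed (simp add: boundary_edge_chain)

lemma abelianization_circuit: "c \<in> circuits G l \<Longrightarrow> abelianization c \<in> H1 G"
proof -
  assume "c \<in> circuits G l"
  hence c: "is_circuit G c" by (simp add: circuits_def)
  then obtain a d where d: "c = a # d" by (cases c) (auto simp: is_circuit_def is_walk_def)
  have s: "set (a # d) \<subseteq> oriented_edges G" "successively (feeds_into G) (a # d)"
    using c is_circuit_Cons_iff[of G a d] successively_append_iff[of "feeds_into G" "a # d" "[a]"]
    by (auto simp: d)
  have "terminal_vertex G (last c) = initial_vertex G a" using c by (auto simp: is_circuit_def d)
  hence b: "boundary G (abelianization c) v = 0" for v
    using boundary_abelianization[OF s] by (simp add: d)
  have "abelianization c \<in> chains G \<and> (\<forall>e. abelianization c $ e \<in> \<int>)"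
    if "set c \<subseteq> oriented_edges G" for c
    using that by (induction c) (auto simp: chains_closed edge_chain_chains edge_chain_Ints)
  from this[OF s(1)] show ?thesis using b by (simp add: H1_eq d)
qed

section \<open>Fundamental domains\<close>

lemma mem_translate_iff: "x \<in> (+) v ` A \<longleftrightarrow> x - v \<in> A" for x :: "'a::ab_group_add"
  by (force simp: image_iff)

lemma translate_sets_borel:
  fixes A :: "'a::euclidean_space set"
  assumes "A \<in> sets borel" shows "(+) v ` A \<in> sets borel"
proof -
  have "(+) v ` A = (\<lambda>x. x - v) -` A \<inter> space borel" by (auto simp: mem_translate_iff)
  also have "\<dots> \<in> sets borel" using assms by (intro measurable_sets) auto
  finally show ?thesis .
qed

lemma fundamental_domain_unique:
  assumes "fundamental_domain V L F" "x \<in> V" "y \<in> F" "x - y \<in> L" "z \<in> F" "x - z \<in> L"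
  shows "y = z"
  using assms unfolding fundamental_domain_def by blast

text \<open>The two domains are cut into countably many pieces that match up under translations by \<open>L\<close>.\<close>

lemma emeasure_fundamental_domain_eq:
  fixes V L :: "'a::euclidean_space set"
  assumes sets: "sets M = sets borel"
    and inv: "\<And>v A. v \<in> L \<Longrightarrow> A \<in> sets borel \<Longrightarrow> emeasure M ((+) v ` A) = emeasure M A"
    and L: "subgrp L" "countable L" "L \<subseteq> V" and V: "Real_Vector_Spaces.subspace V"
    and F: "fundamental_domain V L F" and F': "fundamental_domain V L F'"
    and S: "S \<in> sets borel" "\<And>x v. x \<in> S \<Longrightarrow> v \<in> L \<Longrightarrow> x + v \<in> S"
  shows "emeasure M (F \<inter> S) = emeasure M (F' \<inter> S)"
proof -
  have FD: "F \<in> sets borel" "F \<subseteq> V" "\<And>x. x \<in> V \<Longrightarrow> \<exists>!y. y \<in> F \<and> x - y \<in> L"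
    and FD': "F' \<in> sets borel" "F' \<subseteq> V" "\<And>x. x \<in> V \<Longrightarrow> \<exists>!y. y \<in> F' \<and> x - y \<in> L"
    using F F' by (auto simp: fundamental_domain_def)
  note shift = translate_sets_borel
  \<comment> \<open>Translation by \<open>v\<close> matches the points of \<open>F\<close> that it
    sends into \<open>F'\<close> with the points of \<open>F'\<close> that come from
    \<open>F\<close>; \<open>S\<close> is respected because it is invariant under
    \<open>L\<close>.\<close>
  have eq: "(+) v ` (F \<inter> S \<inter> (+) (-v) ` F') = F' \<inter> S \<inter> (+) v ` F" if v: "v \<in> L" for v
  proof (intro subset_antisym subsetI)
    fix x assume "x \<in> F' \<inter> S \<inter> (+) v ` F"
    then obtain y where y: "y \<in> F" "x = v + y" "x \<in> F'" "x \<in> S" by auto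
    have "y \<in> S" using S(2)[OF y(4), of "-v"] subgrpD(3)[OF L(1) v] y(2) by simp
    moreover have "y = - v + x" using y by simp
    ultimately show "x \<in> (+) v ` (F \<inter> S \<inter> (+) (-v) ` F')" using y by blast
  next
    fix x assume "x \<in> (+) v ` (F \<inter> S \<inter> (+) (-v) ` F')"
    thus "x \<in> F' \<inter> S \<inter> (+) v ` F" using S(2)[OF _ v] by (auto simp: add.commute)
  qed
  have 1: "F \<inter> S = (\<Union>v\<in>L. F \<inter> S \<inter> (+) (-v) ` F')"
  proof (intro subset_antisym subsetI)
    fix x assume x: "x \<in> F \<inter> S"
    then obtain y where y: "y \<in> F'" "x - y \<in> L" using FD'(3)[of x] FD(2) by auto
    hence "y - x \<in> L" using subgrpD(3)[OF L(1) y(2)] by simp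
    moreover have "x = - (y - x) + y" by simp
    ultimately show "x \<in> (\<Union>v\<in>L. F \<inter> S \<inter> (+) (-v) ` F')" using x y by blast
  qed auto
  have 2: "F' \<inter> S = (\<Union>v\<in>L. F' \<inter> S \<inter> (+) v ` F)"
  proof (intro subset_antisym subsetI)
    fix x assume x: "x \<in> F' \<inter> S"
    then obtain y where y: "y \<in> F" "x - y \<in> L" using FD(3)[of x] FD'(2) by auto
    moreover have "x = (x - y) + y" by simp
    ultimately show "x \<in> (\<Union>v\<in>L. F' \<inter> S \<inter> (+) v ` F)" using x by blast
  qed auto
  \<comment> \<open>A point in two pieces would have two representatives in
    \<open>F'\<close>.\<close>
  have d1: "disjoint_family_on (\<lambda>v. F \<inter> S \<inter> (+) (-v) ` F') L"
    unfolding disjoint_family_on_def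
  proof safe
    fix v w y z assume *: "v \<in> L" "w \<in> L" "v \<noteq> w" "y \<in> F'" "z \<in> F'" "-v + y \<in> F" "- v + y = - w + z"
    have "- v + y \<in> V" using * FD(2) by auto
    moreover have "- v + y - y = - v" by simp
    moreover have "- v + y - z = - w" unfolding *(7) by simp
    moreover have "- v \<in> L" "- w \<in> L" using * subgrpD(3)[OF L(1)] by auto
    ultimately have "y = z" using fundamental_domain_unique[OF F'] * by metis
    thus "-v + y \<in> {}" using * by simp
  qed
  have d2: "disjoint_family_on (\<lambda>v. F' \<inter> S \<inter> (+) v ` F) L"
    unfolding disjoint_family_on_def
  proof safe
    fix v w y z assume *: "v \<in> L" "w \<in> L" "v \<noteq> w" "y \<in> F" "z \<in> F" "v + y \<in> F'" "v + y = w + z"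
    have "v + y \<in> V" using * FD'(2) by auto
    moreover have "v + y - y = v" by simp
    moreover have "v + y - z = w" unfolding *(7) by simp
    ultimately have "y = z" using fundamental_domain_unique[OF F] * by metis
    thus "v + y \<in> {}" using * by simp
  qed
  have m1: "F \<inter> S \<inter> (+) (-v) ` F' \<in> sets borel" for v
    by (intro sets.Int shift FD FD' S)
  have m2: "F' \<inter> S \<inter> (+) v ` F \<in> sets borel" for v
    by (intro sets.Int shift FD FD' S)
  have "emeasure M (\<Union>v\<in>L. F \<inter> S \<inter> (+) (-v) ` F') = (\<integral>\<^sup>+v. emeasure M (F \<inter> S \<inter> (+) (-v) ` F') \<partial>count_space L)"
    by (rule emeasure_UN_countable[OF _ L(2) d1]) (simp only: sets m1)
  also have "\<dots> = (\<integral>\<^sup>+v. emeasure M (F' \<inter> S \<inter> (+) v ` F) \<partial>count_space L)"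
  proof (intro nn_integral_cong)
    fix v assume "v \<in> space (count_space L)"
    hence v: "v \<in> L" by simp
    show "emeasure M (F \<inter> S \<inter> (+) (-v) ` F') = emeasure M (F' \<inter> S \<inter> (+) v ` F)"
      using inv[OF v m1[of v]] by (simp only: eq[OF v])
  qed
  also have "\<dots> = emeasure M (\<Union>v\<in>L. F' \<inter> S \<inter> (+) v ` F)"
    by (rule emeasure_UN_countable[OF _ L(2) d2, symmetric]) (simp only: sets m2)
  finally show ?thesis by (simp only: 1[symmetric] 2[symmetric])
qed

lemma fundamental_domain_translate:
  assumes V: "Real_Vector_Spaces.subspace V" and v: "v \<in> V" and F: "fundamental_domain V L F"
  shows "fundamental_domain V L ((+) v ` F)"
  unfolding fundamental_domain_def
proof (intro conjI ballI)
  have FD: "F \<in> sets borel" "F \<subseteq> V" "\<And>x. x \<in> V \<Longrightarrow> \<exists>!y. y \<in> F \<and> x - y \<in> L"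
    using F by (auto simp: fundamental_domain_def)
  show "(+) v ` F \<in> sets borel" by (rule translate_sets_borel[OF FD(1)])
  show "(+) v ` F \<subseteq> V" using FD(2) subspace_add[OF V v] by auto
  fix x assume "x \<in> V"
  hence "x - v \<in> V" using subspace_diff[OF V _ v] by auto
  from FD(3)[OF this] obtain y where y: "y \<in> F" "x - v - y \<in> L" "\<And>z. z \<in> F \<Longrightarrow> x - v - z \<in> L \<Longrightarrow> z = y"
    by blast
  show "\<exists>!y. y \<in> (+) v ` F \<and> x - y \<in> L"
  proof (rule ex1I[of _ "v + y"])
    show "v + y \<in> (+) v ` F \<and> x - (v + y) \<in> L"
      using y(1,2) by (simp add: mem_translate_iff diff_diff_add)
    show "z = v + y" if "z \<in> (+) v ` F \<and> x - z \<in> L" for z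
    proof -
      have "x - z = x - v - (z - v)" by simp
      hence "z - v = y" using that y(3)[of "z - v"] by (simp only: mem_translate_iff)
      thus ?thesis by (simp add: algebra_simps)
    qed
  qed
qed

text \<open>
  Cover a bounded set of representatives by finitely many balls too small to contain two equivalent
  points, and keep from each ball the points not equivalent to a point of an earlier one.
\<close>

lemma bounded_fundamental_domain_exists:
  fixes V L :: "'a::euclidean_space set"
  assumes V: "Real_Vector_Spaces.subspace V" and L: "subgrp L" "L \<subseteq> V"
    and d: "d > 0" "\<And>x. x \<in> L \<Longrightarrow> x \<noteq> 0 \<Longrightarrow> norm x \<ge> d"
    and R: "\<And>x. x \<in> V \<Longrightarrow> \<exists>y\<in>L. norm (x - y) \<le> R"
  obtains F where "fundamental_domain V L F" "bounded F"
proof -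
  have clV: "closed V" by (rule closed_subspace[OF V])
  have k: "compact (cball (0::'a) R)" by simp
  have cov: "cball (0::'a) R \<subseteq> (\<Union>c\<in>UNIV. ball c (d / 2))"
  proof
    fix x :: 'a
    have "x \<in> ball x (d / 2)" using d(1) by simp
    thus "x \<in> (\<Union>c\<in>UNIV. ball c (d / 2))" by blast
  qed
  obtain C where C: "C \<subseteq> UNIV" "finite C" "cball (0::'a) R \<subseteq> (\<Union>c\<in>C. ball c (d / 2))"
    by (rule compactE_image[OF k _ cov]) auto
  obtain cs where cs: "set cs = C" using finite_list[OF C(2)] by auto
  define n where "n = length cs"
  define U where "U i = ball (cs ! i) (d / 2)" for i
  define T where "T i = (\<Union>v\<in>L. (+) v ` U i)" for i
  define F where "F = (\<Union>i<n. (U i \<inter> V) - (\<Union>j<i. T j))"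
  have T: "x \<in> T i \<longleftrightarrow> (\<exists>v\<in>L. x - v \<in> U i)" for x i
    by (simp add: T_def mem_translate_iff)
  have Tinv: "x \<in> T i \<longleftrightarrow> y \<in> T i" if "x - y \<in> L" for x y i
  proof -
    have *: "x \<in> T i" if xy: "x - y \<in> L" and "y \<in> T i" for x y
    proof -
      from that obtain v where v: "v \<in> L" "y - v \<in> U i" by (auto simp: T)
      have "v + (x - y) \<in> L" using v xy subgrpD(4)[OF L(1)] by blast
      moreover have "x - (v + (x - y)) = y - v" by simp
      ultimately show ?thesis unfolding T using v by metis
    qed
    show ?thesis using *[OF that] *[of y x] subgrpD(3)[OF L(1) that] by auto
  qed
  have "open (T i)" for i unfolding T_def U_def by (intro open_UN ballI open_translation) auto
  hence "F \<in> sets borel" unfolding F_def U_def using clV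
    by (intro sets.finite_UN sets.Diff sets.Int) auto
  moreover have "F \<subseteq> V" by (auto simp: F_def)
  moreover have "\<exists>!y. y \<in> F \<and> x - y \<in> L" if x: "x \<in> V" for x
  proof -
    obtain y where y: "y \<in> L" "norm (x - y) \<le> R" using R[OF x] by auto
    hence "x - y \<in> (\<Union>c\<in>C. ball c (d / 2))" by (intro subsetD[OF C(3)]) simp
    then obtain c where "c \<in> C" "x - y \<in> ball c (d / 2)" by blast
    moreover from this obtain i where "i < n" "cs ! i = c"
      using cs unfolding n_def by (metis in_set_conv_nth)
    ultimately have i: "i < n" "x - y \<in> U i" by (auto simp: U_def)
    hence "x \<in> T i" using y by (auto simp: T)
    \<comment> \<open>The first ball whose saturation contains \<open>x\<close>. Balls before it
      contain no point of the class of \<open>x\<close>, and from those after it such points have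
      been removed.\<close>
    define k where "k = (LEAST i. x \<in> T i)"
    have k: "x \<in> T k" "k \<le> i" unfolding k_def using \<open>x \<in> T i\<close> by (rule LeastI, rule Least_le)
    have knot: "x \<notin> T j" if "j < k" for j using that unfolding k_def by (rule not_less_Least)
    obtain v where v: "v \<in> L" "x - v \<in> U k" using k by (auto simp: T)
    have "x - v \<in> F"
    proof -
      have "x - v \<in> V" using x v L(2) subspace_diff[OF V] by blast
      moreover have "x - v \<notin> T j" if "j < k" for j using Tinv[of x "x - v" j] v(1) knot[OF that] by simp
      moreover have "k < n" using k(2) i(1) by simp
      ultimately show ?thesis unfolding F_def using v(2) by blast
    qed
    moreover have "z = x - v" if z: "z \<in> F" "x - z \<in> L" for z
    proof -
      obtain j where j: "j < n" "z \<in> U j" "\<And>i. i < j \<Longrightarrow> z \<notin> T i" using z(1) by (auto simp: F_def)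
      have "z \<in> T j" using j(2) subgrpD(1)[OF L(1)] by (auto simp: T intro!: bexI[of _ 0])
      hence "x \<in> T j" using Tinv[OF z(2)] by simp
      hence "\<not> j < k" using knot by blast
      moreover have "\<not> k < j" using j(3)[of k] Tinv[OF z(2), of k] k(1) by blast
      ultimately have "j = k" by simp
      have "norm (z - (x - v)) < d"
        using j(2) v(2) dist_triangle_half_r[of "cs ! k" z d "x - v"] unfolding \<open>j = k\<close> U_def by (simp add: dist_norm)
      moreover have "z - (x - v) \<in> L"
        using subgrpD(2)[OF L(1) v(1) z(2)] by (simp add: algebra_simps)
      ultimately show ?thesis using d(2)[of "z - (x - v)"] by force
    qed
    moreover have "x - (x - v) \<in> L" using v(1) by simp
    ultimately show ?thesis by (intro ex1I[of _ "x - v"]) blast+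
  qed
  moreover have "bounded F"
    by (rule bounded_subset[of "\<Union>i<n. U i"]) (auto simp: F_def U_def)
  ultimately show ?thesis by (intro that[of F]) (simp_all add: fundamental_domain_def)
qed

section \<open>The volume of a torus\<close>

lemma orthonormal_basis:
  fixes V :: "'a::euclidean_space set"
  assumes "Real_Vector_Spaces.subspace V"
  shows "orthonormal_basis V \<subseteq> V" "pairwise Linear_Algebra.orthogonal (orthonormal_basis V)"
    "b \<in> orthonormal_basis V \<Longrightarrow> norm b = 1" "Real_Vector_Spaces.span (orthonormal_basis V) = V"
    "finite (orthonormal_basis V)"
proof -
  obtain B where "B \<subseteq> V" "pairwise Linear_Algebra.orthogonal B" "\<And>x. x \<in> B \<Longrightarrow> norm x = 1"
      "Real_Vector_Spaces.span B = V"
    using orthonormal_basis_subspace[OF assms] by metis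
  hence "\<exists>B. B \<subseteq> V \<and> pairwise Linear_Algebra.orthogonal B \<and> (\<forall>b\<in>B. norm b = 1) \<and> Real_Vector_Spaces.span B = V"
    by blast
  from someI_ex[OF this]
  show *: "orthonormal_basis V \<subseteq> V" "pairwise Linear_Algebra.orthogonal (orthonormal_basis V)"
    "b \<in> orthonormal_basis V \<Longrightarrow> norm b = 1" "Real_Vector_Spaces.span (orthonormal_basis V) = V" for b
    unfolding orthonormal_basis_def by auto
  have "0 \<notin> orthonormal_basis V" using *(3)[of 0] by auto
  from pairwise_orthogonal_independent[OF *(2) this] show "finite (orthonormal_basis V)"
    by (rule finiteI_independent)
qed

text \<open>A product measure is determined on boxes, where the claim reduces to translation
  invariance of Lebesgue measure on the line in each coordinate.\<close>

lemma PiM_lborel_translate: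
  fixes w :: "'i \<Rightarrow> real"
  assumes I: "finite I"
  shows "distr (Pi\<^sub>M I (\<lambda>_. lborel)) (Pi\<^sub>M I (\<lambda>_. lborel)) (\<lambda>c. \<lambda>i\<in>I. c i + w i) = Pi\<^sub>M I (\<lambda>_. lborel)"
proof -
  interpret product_sigma_finite "\<lambda>_::'i. lborel :: real measure" ..
  let ?P = "Pi\<^sub>M I (\<lambda>_. lborel :: real measure)" and ?s = "\<lambda>c::'i \<Rightarrow> real. \<lambda>i\<in>I. c i + w i"
  have meas: "?s \<in> measurable ?P ?P" by measurable
  show ?thesis
  proof (rule PiM_eqI[OF I])
    fix A :: "'i \<Rightarrow> real set" assume A: "\<And>i. i \<in> I \<Longrightarrow> A i \<in> sets lborel"
    have "emeasure (distr ?P ?P ?s) (Pi\<^sub>E I A) = emeasure ?P (?s -` (Pi\<^sub>E I A) \<inter> space ?P)"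
      using A meas I by (intro emeasure_distr) (auto intro!: sets_PiM_I_finite)
    also have "?s -` (Pi\<^sub>E I A) \<inter> space ?P = Pi\<^sub>E I (\<lambda>i. (+) (w i) -` A i)"
      by (auto simp: space_PiM PiE_iff extensional_def add.commute)
    also have "emeasure ?P \<dots> = (\<Prod>i\<in>I. emeasure lborel ((+) (w i) -` A i))"
    proof (rule emeasure_PiM[OF I])
      fix i assume "i \<in> I"
      have "(+) (w i) -` A i \<inter> space borel \<in> sets borel"
        using A[OF \<open>i \<in> I\<close>] by (intro measurable_sets) auto
      thus "(+) (w i) -` A i \<in> sets lborel" by simp
    qed
    also have "\<dots> = (\<Prod>i\<in>I. emeasure lborel (A i))"
    proof (rule prod.cong)
      fix i assume "i \<in> I"
      have "emeasure lborel (A i) = emeasure (distr lborel borel ((+) (w i))) (A i)"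
        by (simp add: lborel_distr_plus)
      also have "\<dots> = emeasure lborel ((+) (w i) -` A i)"
        using A[OF \<open>i \<in> I\<close>] by (subst emeasure_distr) auto
      finally show "emeasure lborel ((+) (w i) -` A i) = emeasure lborel (A i)" ..
    qed simp
    finally show "emeasure (distr ?P ?P ?s) (Pi\<^sub>E I A) = (\<Prod>i\<in>I. emeasure lborel (A i))" .
  qed simp
qed

lemma sets_subspace_lebesgue [simp]: "sets (subspace_lebesgue V) = sets borel"
  and space_subspace_lebesgue [simp]: "space (subspace_lebesgue V) = UNIV"
  by (simp_all add: subspace_lebesgue_def)

lemma basis_coords_measurable:
  "(\<lambda>c. \<Sum>b\<in>B. c b *\<^sub>R b) \<in> measurable (Pi\<^sub>M B (\<lambda>_. lborel)) (borel :: 'a::euclidean_space measure)"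
  by (intro borel_measurable_sum borel_measurable_scaleR) (auto intro: measurable_compose[OF measurable_component_singleton])

text \<open>In the coordinates of the orthonormal basis, translation by \<open>v\<close> shifts the
  coordinate at \<open>b\<close> by \<open>v \<bullet> b\<close>, and these numbers recover
  \<open>v\<close> because it lies in \<open>V\<close>.\<close>

lemma subspace_lebesgue_translate:
  fixes V :: "'a::euclidean_space set"
  assumes V: "Real_Vector_Spaces.subspace V" and v: "v \<in> V" and A: "A \<in> sets borel"
  shows "emeasure (subspace_lebesgue V) ((+) v ` A) = emeasure (subspace_lebesgue V) A"
proof -
  let ?B = "orthonormal_basis V"
  let ?P = "Pi\<^sub>M ?B (\<lambda>_. lborel :: real measure)"
  let ?f = "\<lambda>c. \<Sum>b\<in>?B. c b *\<^sub>R b"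
  let ?s = "\<lambda>c. \<lambda>b\<in>?B. c b + v \<bullet> b"
  note B = orthonormal_basis[OF V]
  have f: "?f \<in> measurable ?P borel" by (rule basis_coords_measurable)
  have s: "?s \<in> measurable ?P ?P" by measurable
  have v_eq: "(\<Sum>b\<in>?B. (v \<bullet> b) *\<^sub>R b) = v"
    using B v by (intro orthonormal_basis_expand) auto
  have fs: "?f (?s c) = v + ?f c" for c
    using v_eq by (simp add: scaleR_add_left sum.distrib)
  have vA: "(+) v ` A \<in> sets borel" by (rule translate_sets_borel[OF A])
  have "emeasure (subspace_lebesgue V) ((+) v ` A) = emeasure ?P (?f -` ((+) v ` A) \<inter> space ?P)"
    unfolding subspace_lebesgue_def by (rule emeasure_distr[OF f vA])
  also have "\<dots> = emeasure (distr ?P ?P ?s) (?f -` ((+) v ` A) \<inter> space ?P)"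
    by (simp add: PiM_lborel_translate[OF B(5)])
  also have "\<dots> = emeasure ?P (?s -` (?f -` ((+) v ` A) \<inter> space ?P) \<inter> space ?P)"
    by (rule emeasure_distr[OF s measurable_sets[OF f vA]])
  also have "?s -` (?f -` ((+) v ` A) \<inter> space ?P) \<inter> space ?P = ?f -` A \<inter> space ?P"
    using measurable_space[OF s] fs by auto
  also have "emeasure ?P \<dots> = emeasure (subspace_lebesgue V) A"
    unfolding subspace_lebesgue_def by (rule emeasure_distr[OF f A, symmetric])
  finally show ?thesis .
qed

text \<open>By the Cauchy-Schwarz inequality the coordinates of a bounded set lie in a cube, whose
  product measure is finite.\<close>

lemma subspace_lebesgue_bounded_finite:
  fixes V :: "'a::euclidean_space set"
  assumes V: "Real_Vector_Spaces.subspace V" and A: "A \<in> sets borel" "bounded A"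
  shows "emeasure (subspace_lebesgue V) A < \<infinity>"
proof -
  let ?B = "orthonormal_basis V"
  let ?P = "Pi\<^sub>M ?B (\<lambda>_. lborel :: real measure)"
  let ?f = "\<lambda>c. \<Sum>b\<in>?B. c b *\<^sub>R b"
  note B = orthonormal_basis[OF V]
  interpret product_sigma_finite "\<lambda>_::'a. lborel :: real measure" ..
  obtain R where R: "\<And>x. x \<in> A \<Longrightarrow> norm x \<le> R" using A(2) by (auto simp: bounded_iff)
  have coord: "?f c \<bullet> b = c b" if "b \<in> ?B" for c b
  proof -
    have "?f c \<bullet> b = (\<Sum>b'\<in>?B. if b' = b then c b else 0)"
      unfolding inner_sum_left
      using B(2) B(3)[OF that] that
      by (intro sum.cong) (auto simp: pairwise_def Linear_Algebra.orthogonal_def norm_eq_sqrt_inner)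
    thus ?thesis using that B(5) by simp
  qed
  have "?f -` A \<inter> space ?P \<subseteq> Pi\<^sub>E ?B (\<lambda>_. {-R..R})"
  proof
    fix c assume c: "c \<in> ?f -` A \<inter> space ?P"
    have "\<bar>c b\<bar> \<le> R" if "b \<in> ?B" for b
    proof -
      have "\<bar>c b\<bar> \<le> norm (?f c) * norm b" using Cauchy_Schwarz_ineq2[of "?f c" b] coord[OF that] by simp
      also have "\<dots> \<le> R" using R[of "?f c"] c B(3)[OF that] by simp
      finally show ?thesis .
    qed
    thus "c \<in> Pi\<^sub>E ?B (\<lambda>_. {-R..R})" using c by (force simp: space_PiM PiE_iff abs_le_iff)
  qed
  hence "emeasure ?P (?f -` A \<inter> space ?P) \<le> emeasure ?P (Pi\<^sub>E ?B (\<lambda>_. {-R..R}))"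
    by (rule emeasure_mono) (use B(5) in \<open>auto intro!: sets_PiM_I_finite\<close>)
  also have "\<dots> = (\<Prod>b\<in>?B. emeasure lborel {-R..R})" by (rule emeasure_PiM[OF B(5)]) auto
  also have "\<dots> < \<infinity>" by (simp add: ennreal_prod_eq_top less_top[symmetric] emeasure_lborel_Icc_eq del: prod_constant)
  also have "emeasure ?P (?f -` A \<inter> space ?P) = emeasure (subspace_lebesgue V) A"
    unfolding subspace_lebesgue_def by (rule emeasure_distr[OF basis_coords_measurable A(1), symmetric])
  finally show ?thesis .
qed

text \<open>Balls of radius \<open>d / 2\<close> around the points are disjoint, and only countably
  many disjoint open sets fit into a Euclidean space. Countability is what allows measures to be
  summed over lattice translates.\<close>

lemma countable_if_separated:
  fixes L :: "'a::euclidean_space set"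
  assumes d: "d > 0" "\<And>x y. x \<in> L \<Longrightarrow> y \<in> L \<Longrightarrow> x \<noteq> y \<Longrightarrow> dist x y \<ge> d"
  shows "countable L"
proof -
  have inj: "inj_on (\<lambda>x. ball x (d / 2)) L"
  proof (rule inj_onI)
    fix x y assume xy: "x \<in> L" "y \<in> L" "ball x (d / 2) = ball y (d / 2)"
    hence "y \<in> ball x (d / 2)" using d(1) by simp
    thus "x = y" using d(2)[OF xy(1,2)] d(1) by (cases "x = y") auto
  qed
  have "disjnt (ball x (d / 2)) (ball y (d / 2))" if "x \<in> L" "y \<in> L" "x \<noteq> y" for x y
    unfolding disjnt_def using d(2)[OF that] by (subst disjoint_ballI) auto
  hence "disjoint ((\<lambda>x. ball x (d / 2)) ` L)" by (auto simp: pairwise_def)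
  hence "countable ((\<lambda>x. ball x (d / 2)) ` L)"
    by (intro countable_disjoint_open_subsets) auto
  thus ?thesis using inj countable_image_inj_on by blast
qed

section \<open>Quotient of a subspace by a discrete cocompact subgroup\<close>

locale cocompact_subgroup =
  fixes V L :: "'a::euclidean_space set" and d R :: real
  assumes V: "Real_Vector_Spaces.subspace V" and L: "subgrp L" "L \<subseteq> V"
    and d: "d > 0" "\<And>x. x \<in> L \<Longrightarrow> x \<noteq> 0 \<Longrightarrow> norm x \<ge> d"
    and R: "\<And>x. x \<in> V \<Longrightarrow> \<exists>y\<in>L. norm (x - y) \<le> R"
begin

lemma countable_L: "countable L"
  using d subgrpD(2)[OF L(1)] by (intro countable_if_separated[of d]) (auto simp: dist_norm)

abbreviation "\<mu> \<equiv> subspace_lebesgue V"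

text \<open>The very choice made inside \<open>quotient_volume\<close>, so that results about it
  concern that measure itself.\<close>

definition "fdom = (SOME F. fundamental_domain V L F)"

lemma fdom: "fundamental_domain V L fdom"
  unfolding fdom_def by (rule someI_ex) (metis bounded_fundamental_domain_exists[OF V L d R])

lemma fdom_sets: "fdom \<in> sets borel" and fdom_subset: "fdom \<subseteq> V"
  using fdom by (auto simp: fundamental_domain_def)

lemma fundamental_domain_measure:
  assumes "fundamental_domain V L F" "fundamental_domain V L F'"
    and "S \<in> sets borel" "\<And>x v. x \<in> S \<Longrightarrow> v \<in> L \<Longrightarrow> x + v \<in> S"
  shows "emeasure \<mu> (F \<inter> S) = emeasure \<mu> (F' \<inter> S)"
  by (rule emeasure_fundamental_domain_eq[OF _ _ L(1) countable_L L(2) V assms])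
     (use L(2) in \<open>auto intro!: subspace_lebesgue_translate[OF V]\<close>)

text \<open>The chosen domain may be unbounded, but it has the measure of a bounded one.\<close>

lemma emeasure_fdom_finite: "emeasure \<mu> fdom < \<infinity>"
proof -
  obtain F where F: "fundamental_domain V L F" "bounded F"
    using bounded_fundamental_domain_exists[OF V L d R] by metis
  have "emeasure \<mu> fdom = emeasure \<mu> F"
    using fundamental_domain_measure[OF fdom F(1), of UNIV] by simp
  thus ?thesis using subspace_lebesgue_bounded_finite[OF V _ F(2)] F(1)
    by (auto simp: fundamental_domain_def)
qed

lemma V_borel: "V \<in> sets borel"
  using closed_subspace[OF V] by simp

text \<open>The generating family in \<open>quotient_volume\<close>. It is already a sigma-algebra,
  so a set in the quotient is measurable exactly if the union of its cosets is Borel.\<close>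

definition "\<Q> = {A. A \<subseteq> coset L ` V \<and> \<Union>A \<in> sets borel}"

lemma coset_mem_iff:
  assumes "A \<subseteq> coset L ` V" "x \<in> V"
  shows "coset L x \<in> A \<longleftrightarrow> x \<in> \<Union>A"
proof
  assume "x \<in> \<Union>A"
  then obtain X where X: "X \<in> A" "x \<in> X" by auto
  then obtain y where y: "X = coset L y" using assms by auto
  hence "coset L x = X" using X(2) by (simp add: coset_eq_iff[OF L(1)] mem_coset_iff)
  thus "coset L x \<in> A" using X by simp
qed (use self_in_coset[OF L(1)] in auto)

lemma Union_cosets_subset: "A \<subseteq> coset L ` V \<Longrightarrow> \<Union>A \<subseteq> V"
proof
  fix x assume "A \<subseteq> coset L ` V" "x \<in> \<Union>A"
  then obtain y where "y \<in> V" "x - y \<in> L" by (auto simp: mem_coset_iff)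
  thus "x \<in> V" using L(2) subspace_add[OF V, of "x - y" y] by auto
qed

lemma Union_invariant:
  assumes "A \<subseteq> coset L ` V" "x \<in> \<Union>A" "v \<in> L" shows "x + v \<in> \<Union>A"
proof -
  obtain y where y: "coset L y \<in> A" "x - y \<in> L" using assms by (auto simp: mem_coset_iff)
  have "x + v - y \<in> L" using subgrpD(4)[OF L(1) y(2) assms(3)] by (simp add: algebra_simps)
  hence "x + v \<in> coset L y" by (simp add: mem_coset_iff)
  thus ?thesis using y(1) by blast
qed

text \<open>Distinct cosets are disjoint, so complements of families of cosets correspond to
  complements of unions within \<open>V\<close>, and \<open>V\<close> is Borel because it is
  closed.\<close>

lemma sigma_algebra_Q: "sigma_algebra (coset L ` V) \<Q>"
  unfolding sigma_algebra_iff2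
proof (intro conjI ballI allI impI)
  fix A assume A: "A \<in> \<Q>"
  have "\<Union>(coset L ` V - A) = V - \<Union>A"
  proof (intro subset_antisym subsetI)
    fix x assume x: "x \<in> \<Union>(coset L ` V - A)"
    moreover have "x \<in> V" using x Union_cosets_subset[of "coset L ` V - A"] by auto
    ultimately have "coset L x \<in> coset L ` V - A" using coset_mem_iff[of "coset L ` V - A" x] by auto
    thus "x \<in> V - \<Union>A" using coset_mem_iff[of A x] A \<open>x \<in> V\<close> by (auto simp: \<Q>_def)
  next
    fix x assume "x \<in> V - \<Union>A"
    hence "coset L x \<in> coset L ` V - A" using coset_mem_iff[of A x] A by (auto simp: \<Q>_def)
    thus "x \<in> \<Union>(coset L ` V - A)" using self_in_coset[OF L(1)] by blast
  qed
  thus "coset L ` V - A \<in> \<Q>" using A V_borel by (auto simp: \<Q>_def)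
next
  fix A :: "nat \<Rightarrow> 'a set set" assume A: "range A \<subseteq> \<Q>"
  have "\<Union>(\<Union>i. A i) = (\<Union>i. \<Union>(A i))" by auto
  moreover have "(\<Union>i. \<Union>(A i)) \<in> sets borel" using A by (intro sets.countable_UN) (auto simp: \<Q>_def)
  ultimately show "(\<Union>i. A i) \<in> \<Q>" using A by (auto simp: \<Q>_def)
qed (auto simp: \<Q>_def)

abbreviation "M\<^sub>F \<equiv> restrict_space \<mu> fdom"
abbreviation "\<nu> \<equiv> quotient_volume V L"

lemma nu_eq: "\<nu> = distr M\<^sub>F (sigma (coset L ` V) \<Q>) (coset L)"
  by (simp add: quotient_volume_def fdom_def \<Q>_def)

lemma sets_sigma_Q: "sets (sigma (coset L ` V) \<Q>) = \<Q>" and space_sigma_Q: "space (sigma (coset L ` V) \<Q>) = coset L ` V"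
  using sigma_algebra.sets_measure_of_eq[OF sigma_algebra_Q]
    sigma_algebra.space_measure_of_eq[OF sigma_algebra_Q] by auto

lemma sets_nu: "sets \<nu> = \<Q>" and space_nu: "space \<nu> = coset L ` V"
  using sets_sigma_Q space_sigma_Q by (auto simp: nu_eq)

lemma space_MF: "space M\<^sub>F = fdom" by (simp add: space_restrict_space)

lemma sets_MF: "A \<in> sets M\<^sub>F \<longleftrightarrow> A \<subseteq> fdom \<and> A \<in> sets borel"
  using fdom_sets by (simp add: sets_restrict_space_iff)

lemma emeasure_MF: "A \<subseteq> fdom \<Longrightarrow> emeasure M\<^sub>F A = emeasure \<mu> A"
  using fdom_sets by (simp add: emeasure_restrict_space)

text \<open>Shifting the projection by \<open>v\<close> amounts to cutting out of the translated
  domain and translating back, which makes translation invariance applicable.\<close>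

lemma coset_translate_vimage:
  assumes v: "v \<in> V" and A: "A \<in> \<Q>"
  shows "(\<lambda>x. coset L (v + x)) -` A \<inter> fdom = (+) (-v) ` ((+) v ` fdom \<inter> \<Union>A)"
    and "(\<lambda>x. coset L (v + x)) -` A \<inter> fdom \<in> sets borel"
proof -
  have *: "coset L (v + x) \<in> A \<longleftrightarrow> v + x \<in> \<Union>A" if "x \<in> fdom" for x
    using that fdom_subset v A subspace_add[OF V] by (intro coset_mem_iff) (auto simp: \<Q>_def)
  show 1: "(\<lambda>x. coset L (v + x)) -` A \<inter> fdom = (+) (-v) ` ((+) v ` fdom \<inter> \<Union>A)"
  proof (rule Set.set_eqI)
    fix x show "x \<in> (\<lambda>x. coset L (v + x)) -` A \<inter> fdom \<longleftrightarrow> x \<in> (+) (-v) ` ((+) v ` fdom \<inter> \<Union>A)"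
      using *[of x] unfolding Int_iff mem_translate_iff vimage_eq
      by (simp only: diff_minus_eq_add add_diff_cancel_left' add.commute[of x v]) blast
  qed
  show "(\<lambda>x. coset L (v + x)) -` A \<inter> fdom \<in> sets borel"
    unfolding 1 using A by (intro translate_sets_borel sets.Int fdom_sets) (auto simp: \<Q>_def)
qed

lemma coset_translate_measurable:
  assumes v: "v \<in> V"
  shows "(\<lambda>x. coset L (v + x)) \<in> measurable M\<^sub>F (sigma (coset L ` V) \<Q>)"
proof (rule measurable_measure_of)
  show "\<Q> \<subseteq> Pow (coset L ` V)" by (auto simp: \<Q>_def)
  show "(\<lambda>x. coset L (v + x)) \<in> space M\<^sub>F \<rightarrow> coset L ` V"
    using fdom_subset subspace_add[OF V v] by (auto simp: space_MF)
  show "(\<lambda>x. coset L (v + x)) -` A \<inter> space M\<^sub>F \<in> sets M\<^sub>F" if "A \<in> \<Q>" for A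
    using coset_translate_vimage(2)[OF v that] by (simp add: sets_MF space_MF)
qed

text \<open>A translate of a fundamental domain is again a fundamental domain.\<close>

lemma nu_eq_translate:
  assumes v: "v \<in> V"
  shows "\<nu> = distr M\<^sub>F (sigma (coset L ` V) \<Q>) (\<lambda>x. coset L (v + x))" (is "_ = ?N")
proof (rule measure_eqI)
  show "sets \<nu> = sets ?N" by (simp add: nu_eq)
next
  fix A assume "A \<in> sets \<nu>"
  hence A: "A \<in> \<Q>" by (simp add: sets_nu)
  have SA: "\<Union>A \<in> sets borel" "\<And>x v. x \<in> \<Union>A \<Longrightarrow> v \<in> L \<Longrightarrow> x + v \<in> \<Union>A"
    using A Union_invariant[of A] by (auto simp: \<Q>_def)
  have *: "emeasure (distr M\<^sub>F (sigma (coset L ` V) \<Q>) (\<lambda>x. coset L (v + x))) A = emeasure \<mu> ((+) v ` fdom \<inter> \<Union>A)"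
    if v: "v \<in> V" for v
  proof -
    have "emeasure (distr M\<^sub>F (sigma (coset L ` V) \<Q>) (\<lambda>x. coset L (v + x))) A =
        emeasure M\<^sub>F ((\<lambda>x. coset L (v + x)) -` A \<inter> space M\<^sub>F)"
      using A by (intro emeasure_distr coset_translate_measurable v) (simp add: sets_sigma_Q)
    also have "\<dots> = emeasure \<mu> ((\<lambda>x. coset L (v + x)) -` A \<inter> fdom)"
      by (subst emeasure_MF) (auto simp: space_MF)
    also have "\<dots> = emeasure \<mu> ((+) v ` fdom \<inter> \<Union>A)"
      unfolding coset_translate_vimage(1)[OF v A] using v subspace_neg[OF V] SA(1)
      by (intro subspace_lebesgue_translate[OF V] sets.Int translate_sets_borel fdom_sets) auto
    finally show ?thesis .
  qed
  have "emeasure \<nu> A = emeasure \<mu> ((+) 0 ` fdom \<inter> \<Union>A)"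
    using *[OF subspace_0[OF V]] by (simp add: nu_eq)
  also have "\<dots> = emeasure \<mu> ((+) v ` fdom \<inter> \<Union>A)"
    by (intro fundamental_domain_measure fundamental_domain_translate V v fdom subspace_0 SA)
  also have "\<dots> = emeasure ?N A" using *[OF v] ..
  finally show "emeasure \<nu> A = emeasure ?N A" .
qed

lemma emeasure_nu_space: "emeasure \<nu> (space \<nu>) < \<infinity>"
proof -
  have "coset L \<in> measurable M\<^sub>F (sigma (coset L ` V) \<Q>)"
    using coset_translate_measurable[OF subspace_0[OF V]] by simp
  hence "emeasure \<nu> (space \<nu>) = emeasure M\<^sub>F (coset L -` space \<nu> \<inter> space M\<^sub>F)"
    unfolding nu_eq by (subst emeasure_distr) auto
  also have "\<dots> \<le> emeasure M\<^sub>F (space M\<^sub>F)" by (rule emeasure_space)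
  also have "\<dots> < \<infinity>" using emeasure_fdom_finite by (simp add: space_MF emeasure_MF)
  finally show ?thesis .
qed

sublocale nu: finite_measure \<nu>
  using emeasure_nu_space by (intro finite_measureI) auto

text \<open>Measurability on the quotient is tested on the union of a preimage, and this union is
  the part in \<open>V\<close> of the preimage under \<open>g\<close>.\<close>

lemma on_cosets_measurable:
  fixes g :: "'a \<Rightarrow> complex"
  assumes g: "g \<in> borel_measurable borel" and eq: "\<And>x. x \<in> V \<Longrightarrow> \<phi> (coset L x) = g x"
  shows "\<phi> \<in> borel_measurable \<nu>"
proof (rule measurableI)
  fix B :: "complex set" assume B: "B \<in> sets borel"
  have "\<Union>(\<phi> -` B \<inter> coset L ` V) = g -` B \<inter> space borel \<inter> V"
  proof (intro subset_antisym subsetI)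
    fix x assume x: "x \<in> \<Union>(\<phi> -` B \<inter> coset L ` V)"
    have xV: "x \<in> V" using x Union_cosets_subset[of "\<phi> -` B \<inter> coset L ` V"] by auto
    hence "coset L x \<in> \<phi> -` B \<inter> coset L ` V" using x coset_mem_iff[of "\<phi> -` B \<inter> coset L ` V" x] by auto
    thus "x \<in> g -` B \<inter> space borel \<inter> V" using xV eq by auto
  next
    fix x assume "x \<in> g -` B \<inter> space borel \<inter> V"
    thus "x \<in> \<Union>(\<phi> -` B \<inter> coset L ` V)" using eq self_in_coset[OF L(1), of x] by auto
  qed
  moreover have "g -` B \<inter> space borel \<inter> V \<in> sets borel"
    using measurable_sets[OF g B] V_borel by auto
  ultimately show "\<phi> -` B \<inter> space \<nu> \<in> sets \<nu>"
    by (auto simp: sets_nu space_nu \<Q>_def)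
qed simp

text \<open>Translating by \<open>v\<close> leaves the integral unchanged and multiplies the
  integrand by \<open>c\<close>, so the integral equals \<open>c\<close> times itself.\<close>

lemma integral_character_eq_0:
  fixes g :: "'a \<Rightarrow> complex"
  assumes g: "g \<in> borel_measurable borel" and eq: "\<And>x. x \<in> V \<Longrightarrow> \<phi> (coset L x) = g x"
    and v: "v \<in> V" "\<And>x. x \<in> V \<Longrightarrow> g (v + x) = c * g x" "c \<noteq> 1"
  shows "integral\<^sup>L \<nu> \<phi> = 0"
proof -
  have \<phi>: "\<phi> \<in> borel_measurable (sigma (coset L ` V) \<Q>)"
    using on_cosets_measurable[OF g eq] measurable_cong_sets[of \<nu> "sigma (coset L ` V) \<Q>"]
    by (metis (no_types, lifting) sets_nu sets_sigma_Q)
  have *: "integral\<^sup>L \<nu> \<phi> = (\<integral>x. g (v + x) \<partial>M\<^sub>F)" if v: "v \<in> V" for v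
  proof -
    have "integral\<^sup>L \<nu> \<phi> = (\<integral>x. \<phi> (coset L (v + x)) \<partial>M\<^sub>F)"
      by (subst nu_eq_translate[OF v], subst integral_distr[OF coset_translate_measurable[OF v] \<phi>]) simp
    also have "\<dots> = (\<integral>x. g (v + x) \<partial>M\<^sub>F)"
      using fdom_subset subspace_add[OF V v]
      by (intro Bochner_Integration.integral_cong) (auto simp: space_MF eq)
    finally show ?thesis .
  qed
  have "integral\<^sup>L \<nu> \<phi> = (\<integral>x. c * g x \<partial>M\<^sub>F)"
    unfolding *[OF v(1)] using fdom_subset v(2)
    by (intro Bochner_Integration.integral_cong) (auto simp: space_MF)
  also have "\<dots> = c * integral\<^sup>L \<nu> \<phi>" using *[OF subspace_0[OF V]] by simp
  finally show ?thesis using v(3) by simp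
qed

end

section \<open>The character torus\<close>

lemma inner_Ints:
  fixes x y :: "real ^ 'e::finite"
  assumes "\<And>e. x $ e \<in> \<int>" "\<And>e. y $ e \<in> \<int>"
  shows "x \<bullet> y \<in> \<int>"
  using assms unfolding inner_vec_def by (intro Ints_sum) auto

context
  fixes G :: "('v,'e::finite) pre_digraph"
  assumes G: "fin_digraph G" and conn: "Digraph_Component.connected G"
begin

text \<open>Connectedness gives a path in the symmetrized graph. Each step uses an arc or its
  inverse, and adding up these oriented edges gives an integral chain.\<close>

lemma connecting_chain:
  assumes "u \<in> verts G" "v \<in> verts G"
  shows "\<exists>\<alpha>\<in>chains G. (\<forall>e. \<alpha> $ e \<in> \<int>) \<and> (\<forall>w. boundary G \<alpha> w = of_bool (v = w) - of_bool (u = w))"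
proof -
  interpret fin_digraph G by fact
  have reach: "u \<rightarrow>\<^sup>*\<^bsub>with_proj (mk_symmetric G)\<^esub> v"
    using conn assms by (auto simp: Digraph_Component.connected_def strongly_connected_def)
  interpret S: pair_wf_digraph "mk_symmetric G" by (rule wellformed_mk_symmetric)
  from reach show ?thesis
  proof (induction rule: S.reachable_induct)
    case base
    show ?case by (rule bexI[of _ 0]) (auto simp: boundary_0 chains_closed)
  next
    case (step x y)
    then obtain \<alpha> where \<alpha>: "\<alpha> \<in> chains G" "\<And>e. \<alpha> $ e \<in> \<int>"
      "\<And>w. boundary G \<alpha> w = of_bool (x = w) - of_bool (u = w)" by blast
    have "(x, y) \<in> parcs (mk_symmetric G)" using step(2) by simp
    then obtain e where e: "e \<in> arcs G" "(x, y) = (tail G e, head G e) \<or> (x, y) = (head G e, tail G e)"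
      by (auto simp: parcs_mk_symmetric)
    then obtain a where a: "a \<in> oriented_edges G" "initial_vertex G a = x" "terminal_vertex G a = y"
    proof (cases "(x, y) = (tail G e, head G e)")
      case True
      thus ?thesis using e that[of "(e, True)"]
        by (auto simp: oriented_edges_def initial_vertex_def terminal_vertex_def)
    next
      case False
      thus ?thesis using e that[of "(e, False)"]
        by (auto simp: oriented_edges_def initial_vertex_def terminal_vertex_def)
    qed
    show ?case
    proof (rule bexI[of _ "\<alpha> + edge_chain a"], intro conjI allI)
      show "(\<alpha> + edge_chain a) $ e \<in> \<int>" for e using Ints_add[OF \<alpha>(2) edge_chain_Ints[of a e]] by simp
      show "boundary G (\<alpha> + edge_chain a) w = of_bool (y = w) - of_bool (u = w)" for w
        using \<alpha>(3) boundary_edge_chain[OF a(1)] a by (simp add: boundary_add)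
      show "\<alpha> + edge_chain a \<in> chains G" using \<alpha>(1) edge_chain_chains[OF a(1)] by (rule chains_closed)
    qed
  qed
qed

text \<open>A form orthogonal to all integral cycles has a potential, namely its values on connecting chains.\<close>

lemma harmonic_eq_0_if_orthogonal_H1:
  assumes \<eta>: "\<eta> \<in> harmonic_forms G" and orth: "\<And>\<alpha>. \<alpha> \<in> H1 G \<Longrightarrow> \<eta> \<bullet> \<alpha> = 0"
  shows "\<eta> = 0"
proof -
  interpret fin_digraph G by fact
  obtain u where u: "u \<in> verts G"
    using conn by (auto simp: Digraph_Component.connected_def strongly_connected_def)
  obtain p where p: "\<And>v. v \<in> verts G \<Longrightarrow> p v \<in> chains G"
    "\<And>v e. v \<in> verts G \<Longrightarrow> p v $ e \<in> \<int>"
    "\<And>v w. v \<in> verts G \<Longrightarrow> boundary G (p v) w = of_bool (v = w) - of_bool (u = w)"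
    using connecting_chain[OF u] by metis
  have "\<eta> \<in> exact_forms G"
    unfolding exact_forms_def
  proof (intro CollectI conjI exI[of _ "\<lambda>v. \<eta> \<bullet> p v"] ballI)
    show "\<eta> \<in> one_forms G" using \<eta> harmonic_subset by auto
    fix e assume e: "e \<in> arcs G"
    let ?c = "edge_chain (e, True)" and ?h = "p (head G e)" and ?t = "p (tail G e)"
    have o: "(e, True) \<in> oriented_edges G" using e by (simp add: oriented_edges_def)
    have v: "head G e \<in> verts G" "tail G e \<in> verts G" using e by auto
    have "?h - ?t - ?c \<in> H1 G"
      unfolding H1_eq
    proof (intro CollectI conjI allI ballI)
      show "?h - ?t - ?c \<in> chains G" by (intro chains_closed p v edge_chain_chains o)
      show "(?h - ?t - ?c) $ e' \<in> \<int>" for e'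
        using p(2)[OF v(1)] p(2)[OF v(2)] edge_chain_Ints by (auto intro!: Ints_diff)
      show "boundary G (?h - ?t - ?c) w = 0" for w
        using p(3)[OF v(1), of w] p(3)[OF v(2), of w] boundary_edge_chain[OF o, of w]
        by (simp add: boundary_diff initial_vertex_def terminal_vertex_def)
    qed
    from orth[OF this] have "\<eta> \<bullet> ?c = \<eta> \<bullet> ?h - \<eta> \<bullet> ?t" by (simp add: inner_diff_right)
    moreover have "\<eta> \<bullet> ?c = \<eta> $ e" by (simp add: edge_chain_def inner_axis)
    ultimately show "\<eta> $ e = \<eta> \<bullet> ?h - \<eta> \<bullet> ?t" by simp
  qed
  from harmonic_orthogonal_exact[OF G \<eta> this] show ?thesis by simp
qed

text \<open>A short form has pairings of absolute value below 1 with finitely many cycles spanning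
  \<open>H1 G\<close>. Being integers they vanish, so the form is orthogonal to all cycles and hence
  zero.\<close>

lemma dual_lattice_separated:
  "\<exists>d>0. \<forall>\<eta>\<in>dual_lattice G (H1 G). \<eta> \<noteq> 0 \<longrightarrow> d \<le> norm \<eta>"
proof -
  obtain B where B: "B \<subseteq> H1 G" "finite B" "H1 G \<subseteq> Real_Vector_Spaces.span B"
    using Real_Vector_Spaces.maximal_independent_subset[of "H1 G"] finiteI_independent by metis
  \<comment> \<open>The denominator exceeds every norm in \<open>B\<close> and stays positive when
    \<open>B\<close> is empty.\<close>
  define d where "d = 1 / (1 + (\<Sum>\<alpha>\<in>B. norm \<alpha>))"
  have s: "(\<Sum>\<alpha>\<in>B. norm \<alpha>) \<ge> 0" by (intro sum_nonneg) auto
  have "\<eta> = 0" if \<eta>: "\<eta> \<in> dual_lattice G (H1 G)" and less: "norm \<eta> < d" for \<eta>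
  proof -
    have "\<eta> \<bullet> \<alpha> = 0" if \<alpha>: "\<alpha> \<in> B" for \<alpha>
    proof -
      have "\<bar>\<eta> \<bullet> \<alpha>\<bar> \<le> norm \<eta> * norm \<alpha>" by (rule Cauchy_Schwarz_ineq2)
      also have "\<dots> \<le> norm \<eta> * (1 + (\<Sum>\<alpha>\<in>B. norm \<alpha>))"
        using member_le_sum[OF \<alpha>, of norm] B(2) by (intro mult_left_mono) auto
      also have "\<dots> < 1" using less s by (simp add: d_def field_simps)
      finally have "\<bar>\<eta> \<bullet> \<alpha>\<bar> < 1" .
      moreover have "\<eta> \<bullet> \<alpha> \<in> \<int>" using \<eta> \<alpha> B(1) by (auto simp: dual_lattice_def)
      ultimately show ?thesis using Ints_nonzero_abs_less1 by blast
    qed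
    hence "\<eta> \<bullet> \<alpha> = 0" if "\<alpha> \<in> Real_Vector_Spaces.span B" for \<alpha>
      using orthogonal_to_span[OF that, of \<eta>] by (auto simp: Linear_Algebra.orthogonal_def)
    thus ?thesis using \<eta> B(3) by (intro harmonic_eq_0_if_orthogonal_H1) (auto simp: dual_lattice_def)
  qed
  moreover have "d > 0" using s by (simp add: d_def)
  ultimately show ?thesis by (metis linorder_not_less)
qed

text \<open>Round the coordinates of \<open>x\<close>: the harmonic part of an integral form lies in the dual lattice.\<close>

lemma dual_lattice_cobounded:
  assumes x: "x \<in> harmonic_forms G"
  shows "\<exists>y\<in>dual_lattice G (H1 G). norm (x - y) \<le> real CARD('e)"
proof -
  define k :: "real ^ 'e" where "k = (\<chi> e. of_int \<lfloor>x $ e\<rfloor>)"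
  have k: "k \<in> one_forms G"
    using x by (auto simp: harmonic_forms_def one_forms_def k_def)
  let ?y = "harmonic_part G k"
  note y = harmonic_part[OF G k]
  have "?y \<in> dual_lattice G (H1 G)"
    unfolding dual_lattice_def
  proof (intro CollectI conjI ballI y(1))
    fix \<alpha> assume \<alpha>: "\<alpha> \<in> H1 G"
    hence "?y \<bullet> \<alpha> = k \<bullet> \<alpha>" using H1_subset_harmonic by (intro inner_harmonic_part[OF G k]) auto
    also have "\<dots> \<in> \<int>" using \<alpha> by (intro inner_Ints) (auto simp: k_def H1_eq)
    finally show "?y \<bullet> \<alpha> \<in> \<int>" .
  qed
  moreover have "norm (x - ?y) \<le> real CARD('e)"
  proof -
    have d: "x - ?y \<in> harmonic_forms G" using x y(1) subspace_diff[OF subspace_harmonic] by blast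
    \<comment> \<open>\<open>x - ?y\<close> is the projection of \<open>x - k\<close> to the
      harmonic forms, hence no longer than \<open>x - k\<close>, whose coordinates are fractional
      parts.\<close>
    have "(x - ?y) \<bullet> (k - ?y) = 0" by (rule harmonic_orthogonal_exact[OF G d y(2)])
    hence "(x - ?y) \<bullet> (x - ?y) = (x - ?y) \<bullet> (x - k)" by (simp add: inner_diff_right)
    also have "\<dots> \<le> norm (x - ?y) * norm (x - k)" by (rule norm_cauchy_schwarz)
    finally have "norm (x - ?y) \<le> norm (x - k)"
      by (cases "norm (x - ?y) = 0") (auto simp: dot_square_norm power2_eq_square)
    also have "\<dots> \<le> (\<Sum>e\<in>UNIV. \<bar>(x - k) $ e\<bar>)" by (rule norm_le_l1_cart)
    also have "\<dots> \<le> (\<Sum>e\<in>(UNIV::'e set). 1)"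
    proof (rule sum_mono)
      fix e
      have "(x - k) $ e = frac (x $ e)" by (simp add: k_def frac_def)
      thus "\<bar>(x - k) $ e\<bar> \<le> 1" using frac_ge_0[of "x $ e"] frac_lt_1[of "x $ e"] by linarith
    qed
    finally show ?thesis by simp
  qed
  ultimately show ?thesis by blast
qed

lemma cocompact_dual_lattice:
  "\<exists>d. cocompact_subgroup (harmonic_forms G) (dual_lattice G (H1 G)) d (real CARD('e))"
proof -
  obtain d where d: "d > 0" "\<forall>\<eta>\<in>dual_lattice G (H1 G). \<eta> \<noteq> 0 \<longrightarrow> d \<le> norm \<eta>"
    using dual_lattice_separated by blast
  have "cocompact_subgroup (harmonic_forms G) (dual_lattice G (H1 G)) d (real CARD('e))"
    by unfold_locales
       (use d dual_lattice_cobounded subspace_harmonic subgrp_dual_lattice in \<open>auto simp: dual_lattice_def\<close>)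
  thus ?thesis by blast
qed

end

text \<open>\<open>the_elem\<close> gives the expected value only if \<open>f\<close> is constant on
  the class. The agreement of characters yields equal spectral sums, and the equality of classes
  keeps a form in the set for which \<open>h\<close> is a test function.\<close>

lemma on_class_eq:
  fixes f :: "real ^ 'e \<Rightarrow> 'b"
  assumes G: "fin_digraph G" and \<eta>: "\<eta> \<in> harmonic_forms G"
    and f: "\<And>\<omega>. \<omega> \<in> one_forms G \<Longrightarrow> (\<And>\<alpha>. \<alpha> \<in> H1 G \<Longrightarrow> chr \<omega> \<alpha> = chr \<eta> \<alpha>) \<Longrightarrow>
        form_class G \<omega> = coset (dual_lattice G (H1 G)) \<eta> \<Longrightarrow> f \<omega> = f \<eta>"
  shows "on_class G f (coset (dual_lattice G (H1 G)) \<eta>) = f \<eta>"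
proof -
  let ?x = "coset (dual_lattice G (H1 G)) \<eta>"
  have "\<eta> \<in> one_forms G" using \<eta> harmonic_subset by auto
  hence "\<eta> \<in> {\<omega> \<in> one_forms G. form_class G \<omega> = ?x}" by (simp add: form_class_harmonic[OF G \<eta>])
  moreover have "f \<omega> = f \<eta>" if "\<omega> \<in> {\<omega> \<in> one_forms G. form_class G \<omega> = ?x}" for \<omega>
    using that form_class_chr[OF G _ \<eta>] by (intro f) auto
  ultimately have "f ` {\<omega> \<in> one_forms G. form_class G \<omega> = ?x} = {f \<eta>}" by blast
  thus ?thesis by (simp add: on_class_def)
qed

lemma integral_character:
  fixes G :: "('v,'e::finite) pre_digraph"
  assumes G: "fin_digraph G" and conn: "Digraph_Component.connected G" and \<beta>: "\<beta> \<in> H1 G"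
    and \<phi>: "\<And>\<eta>. \<eta> \<in> harmonic_forms G \<Longrightarrow> \<phi> (coset (dual_lattice G (H1 G)) \<eta>) = chr \<eta> \<beta>"
  shows "integrable (dV G) \<phi>"
    and "integral\<^sup>L (dV G) \<phi> = (if \<beta> = 0 then of_real (measure (dV G) (char_torus G)) else 0)"
proof -
  let ?V = "harmonic_forms G" and ?L = "dual_lattice G (H1 G)"
  obtain d where "cocompact_subgroup ?V ?L d (real CARD('e))"
    using cocompact_dual_lattice[OF G conn] by blast
  then interpret cocompact_subgroup ?V ?L d "real CARD('e)" .
  have dV: "dV G = quotient_volume ?V ?L" by (simp add: dV_def)
  have m: "(\<lambda>\<eta>. chr \<eta> \<beta>) \<in> borel_measurable borel"
    unfolding chr_def by (intro borel_measurable_continuous_onI continuous_intros)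
  have \<phi>m: "\<phi> \<in> borel_measurable (dV G)" unfolding dV by (rule on_cosets_measurable[OF m \<phi>])
  have n: "norm (\<phi> x) \<le> 1" if "x \<in> space (dV G)" for x
    using that \<phi> by (auto simp: dV space_nu)
  show "integrable (dV G) \<phi>"
    using \<phi>m n unfolding dV by (intro nu.integrable_const_bound[of _ 1]) auto
  show "integral\<^sup>L (dV G) \<phi> = (if \<beta> = 0 then of_real (measure (dV G) (char_torus G)) else 0)"
  proof (cases "\<beta> = 0")
    case True
    have "integral\<^sup>L (dV G) \<phi> = (\<integral>x. 1 \<partial>dV G)"
      using \<phi> True by (intro Bochner_Integration.integral_cong) (auto simp: dV space_nu)
    also have "\<dots> = of_real (measure (dV G) (space (dV G)))"
      by (simp add: scaleR_conv_of_real)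
    finally show ?thesis using True by (simp add: dV space_nu char_torus_def)
  next
    case False
    let ?v = "(1 / (2 * (\<beta> \<bullet> \<beta>))) *\<^sub>R \<beta>"
    have "?v \<in> ?V" using \<beta> H1_subset_harmonic by (intro subspace_scale[OF subspace_harmonic]) auto
    moreover have "chr ?v \<beta> = -1" using False by (simp add: chr_eq_cis)
    ultimately have "integral\<^sup>L (dV G) \<phi> = 0"
      unfolding dV by (intro integral_character_eq_0[OF m \<phi>, of ?v "-1"]) (auto simp: chr_add_left)
    thus ?thesis using False by simp
  qed
qed

section \<open>Spectral sums and circuit counts\<close>

lemma sums_sum_mset:
  fixes f :: "'b \<Rightarrow> nat \<Rightarrow> 'a::real_normed_vector"
  assumes "\<And>z. z \<in># M \<Longrightarrow> f z sums s z"
  shows "(\<lambda>l. \<Sum>z\<in>#M. f z l) sums (\<Sum>z\<in>#M. s z)"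
  using assms by (induction M) (auto intro: sums_add)

text \<open>The finite sum over eigenvalues is exchanged with the Taylor series, and the power sums
  of eigenvalues are the weighted circuit counts.\<close>

lemma spec_sum_sums:
  assumes es: "distinct es" "set es = arcs G"
    and tf: "test_function G es S \<epsilon> h \<gamma>" and \<omega>: "\<omega> \<in> S"
  shows "(\<lambda>l. coef h \<gamma> (Suc l) * (\<Sum>c\<in>circuits G (Suc l). chr \<omega> (abelianization c)))
           sums spec_sum G es h \<omega>"
proof -
  have "(\<lambda>l. \<Sum>z\<in>#spec (W1 G es \<omega>). coef h \<gamma> (Suc l) * z ^ Suc l) sums spec_sum G es h \<omega>"
    unfolding spec_sum_def
    by (intro sums_sum_mset coef_sums(1)[OF tf \<omega>] norm_spec_le_rho[OF W1_carrier])
  thus ?thesis by (simp only: sum_mset_distrib_left[symmetric] trace_W1_power[OF es])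
qed

lemma norm_sum_mset_le: "norm (\<Sum>z\<in>#M. f z) \<le> (\<Sum>z\<in>#M. norm (f z))"
  by (induction M) (auto intro: norm_triangle_le)

text \<open>At \<omega> = 0 every circuit has weight 1, so the number of circuits is itself a trace
  and is at most a power sum of eigenvalue moduli. The resulting bound is the same for all
  characters, as termwise integration over the torus requires.\<close>

lemma summable_coef_card_circuits:
  assumes es: "distinct es" "set es = arcs G"
    and tf: "test_function G es S \<epsilon> h \<gamma>" and 0: "0 \<in> S"
  shows "summable (\<lambda>l. norm (coef h \<gamma> (Suc l)) * real (card (circuits G (Suc l))))"
proof -
  let ?M = "spec (W1 G es 0)"
  have "(\<lambda>l. \<Sum>z\<in>#?M. norm (coef h \<gamma> (Suc l)) * norm z ^ Suc l) sums
      (\<Sum>z\<in>#?M. (\<Sum>l. norm (coef h \<gamma> (Suc l)) * norm z ^ Suc l))"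
    by (intro sums_sum_mset summable_sums coef_sums(2)[OF tf 0] norm_spec_le_rho[OF W1_carrier])
  hence "summable (\<lambda>l. \<Sum>z\<in>#?M. norm (coef h \<gamma> (Suc l)) * norm z ^ Suc l)"
    by (rule sums_summable)
  moreover have "norm (norm (coef h \<gamma> (Suc l)) * real (card (circuits G (Suc l))))
      \<le> (\<Sum>z\<in>#?M. norm (coef h \<gamma> (Suc l)) * norm z ^ Suc l)" for l
  proof -
    have "of_nat (card (circuits G (Suc l))) = (\<Sum>z\<in>#?M. z ^ Suc l)"
      unfolding trace_W1_power[OF es] by simp
    hence "real (card (circuits G (Suc l))) = norm (\<Sum>z\<in>#?M. z ^ Suc l)" by (metis norm_of_nat)
    also have "\<dots> \<le> (\<Sum>z\<in>#?M. norm (z ^ Suc l))" by (rule norm_sum_mset_le)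
    finally have "real (card (circuits G (Suc l))) \<le> (\<Sum>z\<in>#?M. norm z ^ Suc l)"
      by (simp only: norm_power)
    hence "norm (coef h \<gamma> (Suc l)) * real (card (circuits G (Suc l)))
        \<le> norm (coef h \<gamma> (Suc l)) * (\<Sum>z\<in>#?M. norm z ^ Suc l)"
      by (intro mult_left_mono) auto
    thus ?thesis by (simp only: sum_mset_distrib_left) simp
  qed
  ultimately show ?thesis by (rule summable_comparison_test')
qed

text \<open>Both sums are limits of the same circuit series, since abelianizations of circuits lie
  in \<open>H1 G\<close>.\<close>

lemma spec_sum_cong:
  assumes es: "distinct es" "set es = arcs G"
    and tf: "test_function G es S \<epsilon> h \<gamma>" and "\<omega> \<in> S" "\<eta> \<in> S"
    and eq: "\<And>\<alpha>. \<alpha> \<in> H1 G \<Longrightarrow> chr \<omega> \<alpha> = chr \<eta> \<alpha>"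
  shows "spec_sum G es h \<omega> = spec_sum G es h \<eta>"
proof -
  have "(\<Sum>c\<in>circuits G (Suc l). chr \<omega> (abelianization c)) = (\<Sum>c\<in>circuits G (Suc l). chr \<eta> (abelianization c))" for l
    by (intro sum.cong) (auto intro: eq abelianization_circuit)
  hence "(\<lambda>l. coef h \<gamma> (Suc l) * (\<Sum>c\<in>circuits G (Suc l). chr \<eta> (abelianization c))) sums spec_sum G es h \<omega>"
    using spec_sum_sums[OF es tf \<open>\<omega> \<in> S\<close>] by simp
  thus ?thesis using spec_sum_sums[OF es tf \<open>\<eta> \<in> S\<close>] by (rule sums_unique2)
qed

lemma num_circuits_eq: "num_circuits G \<alpha> l = card {c \<in> circuits G l. abelianization c = \<alpha>}"
  unfolding num_circuits_def circuits_def by (rule arg_cong[of _ _ card]) auto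

lemma num_circuits_mod_eq:
  "num_circuits_mod G \<Lambda> A l = card {c \<in> circuits G l. coset \<Lambda> (abelianization c) = A}"
  unfolding num_circuits_mod_def circuits_def by (rule arg_cong[of _ _ card]) auto

lemma sum_fibres:
  fixes f :: "'b \<Rightarrow> 'c::comm_semiring_1"
  assumes "finite C" "finite A" "p ` C \<subseteq> A"
  shows "(\<Sum>c\<in>C. f (p c)) = (\<Sum>a\<in>A. f a * of_nat (card {c \<in> C. p c = a}))"
proof -
  have "(\<Sum>c\<in>C. f (p c)) = (\<Sum>a\<in>A. \<Sum>c | c \<in> C \<and> p c = a. f (p c))"
    using sum.group[OF assms, of "\<lambda>c. f (p c)"] by simp
  also have "\<dots> = (\<Sum>a\<in>A. f a * of_nat (card {c \<in> C. p c = a}))"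
    by (intro sum.cong) (auto simp: mult.commute)
  finally show ?thesis .
qed

text \<open>Only finitely many cycles come from circuits of length \<open>l\<close>, so the sum over
  \<open>H1 G\<close> has finite support.\<close>

lemma infsum_num_circuits:
  "(\<Sum>\<^sub>\<infinity>\<alpha>\<in>H1 G. chr \<omega> \<alpha> * of_nat (num_circuits G \<alpha> l) * k) =
     k * (\<Sum>c\<in>circuits G l. chr \<omega> (abelianization c))"
proof -
  let ?A = "abelianization ` circuits G l"
  have "(\<Sum>\<^sub>\<infinity>\<alpha>\<in>H1 G. chr \<omega> \<alpha> * of_nat (num_circuits G \<alpha> l) * k) =
      (\<Sum>\<^sub>\<infinity>\<alpha>\<in>?A. chr \<omega> \<alpha> * of_nat (num_circuits G \<alpha> l) * k)"
  proof (rule infsum_cong_neutral)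
    fix \<alpha> assume "\<alpha> \<in> H1 G - ?A"
    hence "{c \<in> circuits G l. abelianization c = \<alpha>} = {}" by auto
    thus "chr \<omega> \<alpha> * of_nat (num_circuits G \<alpha> l) * k = 0" by (simp add: num_circuits_eq)
  qed (use abelianization_circuit in auto)
  also have "\<dots> = k * (\<Sum>\<alpha>\<in>?A. chr \<omega> \<alpha> * of_nat (card {c \<in> circuits G l. abelianization c = \<alpha>}))"
    by (simp add: num_circuits_eq sum_distrib_left mult_ac)
  also have "\<dots> = k * (\<Sum>c\<in>circuits G l. chr \<omega> (abelianization c))"
    by (subst sum_fibres[of "circuits G l" ?A]) auto
  finally show ?thesis .
qed

lemma chr_coset_eq:
  assumes \<Lambda>: "subgrp \<Lambda>" and "\<And>\<beta>. \<beta> \<in> \<Lambda> \<Longrightarrow> chr \<omega> \<beta> = 1"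
  shows "chr_coset \<omega> (coset \<Lambda> \<alpha>) = chr \<omega> \<alpha>"
proof -
  have "chr \<omega> ` coset \<Lambda> \<alpha> = {chr \<omega> \<alpha>}"
    using assms subgrpD(1)[OF \<Lambda>] by (auto simp: coset_def chr_add image_iff intro!: bexI[of _ 0])
  thus ?thesis by (simp add: chr_coset_def)
qed

text \<open>The class has a representative that is integral on \<open>\<Lambda>\<close>, and
  changing the representative does not affect characters of cycles. This makes
  \<open>chr_coset\<close> meaningful for such forms.\<close>

lemma quot_dual_chr:
  assumes G: "fin_digraph G" and \<Lambda>: "finite_index_subgroup G \<Lambda>"
    and \<omega>: "\<omega> \<in> one_forms G" "form_class G \<omega> \<in> quot_dual G \<Lambda>" and \<beta>: "\<beta> \<in> \<Lambda>"
  shows "chr \<omega> \<beta> = 1"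
proof -
  obtain \<eta> where \<eta>: "\<eta> \<in> dual_lattice G \<Lambda>" "form_class G \<omega> = coset (dual_lattice G (H1 G)) \<eta>"
    using \<omega>(2) by (auto simp: quot_dual_def)
  have "chr \<omega> \<beta> = chr \<eta> \<beta>"
    using \<eta> \<beta> finite_index_subgroupD(2)[OF \<Lambda>]
    by (intro form_class_chr[OF G \<omega>(1) _ \<eta>(2)]) (auto simp: dual_lattice_def)
  also have "\<dots> = 1" using \<eta>(1) \<beta> by (simp add: chr_eq_1_iff dual_lattice_def)
  finally show ?thesis .
qed

section \<open>Separating points from subgroups of an integral lattice\<close>

lemma subgrp_of_int_scaleR:
  fixes x :: "'a::real_vector"
  assumes L: "subgrp L" and x: "x \<in> L"
  shows "of_int k *\<^sub>R x \<in> L"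
proof -
  have n: "of_nat n *\<^sub>R x \<in> L" for n
  proof (induction n)
    case (Suc n)
    thus ?case using subgrpD(4)[OF L x Suc] by (simp add: scaleR_add_left)
  qed (simp add: subgrpD(1)[OF L])
  show ?thesis
  proof (cases k rule: int_cases2)
    case (nonneg n)
    thus ?thesis using n[of n] by simp
  next
    case (nonpos n)
    thus ?thesis using subgrpD(3)[OF L n[of n]] by simp
  qed
qed

text \<open>The least positive element generates, by division with remainder; in the trivial
  subgroup the generator is 0.\<close>

lemma int_subgrp_principal:
  fixes K :: "int set"
  assumes K: "subgrp K"
  shows "\<exists>d\<in>K. \<forall>k\<in>K. d dvd k"
proof (cases "K \<subseteq> {0}")
  case True
  thus ?thesis using subgrpD(1)[OF K] by auto
next
  case False
  then obtain a where a: "a \<in> K" "a \<noteq> 0" by auto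
  have "\<bar>a\<bar> \<in> K" using a subgrpD(3)[OF K a(1)] by (simp add: abs_if)
  define P where "P n \<longleftrightarrow> n > 0 \<and> int n \<in> K" for n
  have "P (nat \<bar>a\<bar>)" using a \<open>\<bar>a\<bar> \<in> K\<close> by (simp add: P_def)
  hence P: "P (LEAST n. P n)" by (rule LeastI)
  define d where "d = int (LEAST n. P n)"
  have d: "d > 0" "d \<in> K" using P by (auto simp: d_def P_def)
  have dK: "d * j \<in> K" for j
  proof -
    have n: "d * int n \<in> K" for n
      by (induction n) (use subgrpD[OF K] d in \<open>auto simp: distrib_left\<close>)
    show ?thesis using n[of "nat j"] subgrpD(3)[OF K n[of "nat (-j)"]] by (cases "j \<ge> 0") auto
  qed
  have "d dvd k" if k: "k \<in> K" for k
  proof (rule ccontr)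
    assume nd: "\<not> d dvd k"
    have "k mod d = k - d * (k div d)" by (simp add: minus_mult_div_eq_mod)
    hence "k mod d \<in> K" using subgrpD(2)[OF K k dK] by simp
    moreover have "k mod d \<noteq> 0" "k mod d \<ge> 0" "k mod d < d" using nd d(1) by (auto simp: dvd_eq_mod_eq_0)
    ultimately have "P (nat (k mod d))" "nat (k mod d) < (LEAST n. P n)" by (auto simp: P_def d_def)
    thus False using not_less_Least by blast
  qed
  thus ?thesis using d by auto
qed

text \<open>
  Induction on the support: either a multiple of a coordinate separates, or \<open>\<beta>\<close> can be moved into the
  hyperplane \<open>x\<^sub>e = 0\<close> by a multiple of an element \<open>m\<close> of \<open>\<Lambda>\<close> whose coordinate at \<open>e\<close> generates all of them.
\<close>

lemma separate_integral_subgroup: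
  fixes \<Lambda> :: "(real ^ 'e::finite) set"
  assumes "finite S" "subgrp \<Lambda>"
    and "\<And>x e. x \<in> \<Lambda> \<Longrightarrow> x $ e \<in> \<int>" "\<And>x e. x \<in> \<Lambda> \<Longrightarrow> e \<notin> S \<Longrightarrow> x $ e = 0"
    and "\<And>e. \<beta> $ e \<in> \<int>" "\<And>e. e \<notin> S \<Longrightarrow> \<beta> $ e = 0" "\<beta> \<notin> \<Lambda>"
  shows "\<exists>\<eta>. (\<forall>x\<in>\<Lambda>. \<eta> \<bullet> x \<in> \<int>) \<and> \<eta> \<bullet> \<beta> \<notin> \<int>"
  using assms
proof (induction S arbitrary: \<Lambda> \<beta> rule: finite_induct)
  case empty
  hence "\<beta> = 0" by (simp add: Finite_Cartesian_Product.vec_eq_iff)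
  thus ?case using empty subgrpD(1) by blast
next
  case (insert e S \<Lambda> \<beta>)
  note L = \<open>subgrp \<Lambda>\<close>
  define K where "K = {k::int. \<exists>x\<in>\<Lambda>. x $ e = of_int k}"
  have "subgrp K"
    unfolding subgrp_def
  proof (intro conjI ballI)
    show "0 \<in> K" using subgrpD(1)[OF L] by (auto simp: K_def intro!: bexI[of _ 0])
    fix j k assume "j \<in> K" "k \<in> K"
    then obtain x y where "x \<in> \<Lambda>" "x $ e = of_int j" "y \<in> \<Lambda>" "y $ e = of_int k" by (auto simp: K_def)
    thus "j - k \<in> K" using subgrpD(2)[OF L, of x y] by (auto simp: K_def intro!: bexI[of _ "x - y"])
  qed
  then obtain d where d: "d \<in> K" "\<And>k. k \<in> K \<Longrightarrow> d dvd k" using int_subgrp_principal by blast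
  then obtain m where m: "m \<in> \<Lambda>" "m $ e = of_int d" by (auto simp: K_def)
  have mult: "\<exists>j::int. x $ e = of_int j * m $ e" if x: "x \<in> \<Lambda>" for x
  proof -
    obtain k where k: "x $ e = of_int k" using insert.prems(2)[OF x] by (auto elim: Ints_cases)
    hence "k \<in> K" using x by (auto simp: K_def)
    then obtain j where "k = d * j" using d(2) by (auto simp: dvd_def)
    thus ?thesis using k m(2) by (intro exI[of _ j]) simp
  qed
  show ?case
  proof (cases "\<exists>j::int. \<beta> $ e = of_int j * m $ e")
    case True
    then obtain j :: int where j: "\<beta> $ e = of_int j * m $ e" by blast
    let ?\<beta> = "\<beta> - of_int j *\<^sub>R m" and ?\<Lambda> = "{x \<in> \<Lambda>. x $ e = 0}"
    have jm: "of_int k *\<^sub>R m \<in> \<Lambda>" for k by (rule subgrp_of_int_scaleR[OF L m(1)])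
    have "\<exists>\<eta>. (\<forall>x\<in>?\<Lambda>. \<eta> \<bullet> x \<in> \<int>) \<and> \<eta> \<bullet> ?\<beta> \<notin> \<int>"
    proof (rule insert.IH)
      show "subgrp ?\<Lambda>" using L by (auto simp: subgrp_def)
      show "x $ e' = 0" if "x \<in> ?\<Lambda>" "e' \<notin> S" for x e'
        using that insert.prems(3)[of x e'] by (cases "e' = e") auto
      show "?\<beta> $ e' = 0" if "e' \<notin> S" for e'
        using that insert.prems(5)[of e'] insert.prems(3)[OF m(1), of e'] j by (cases "e' = e") auto
      show "?\<beta> $ e' \<in> \<int>" for e'
        using insert.prems(2)[OF jm, of j e'] insert.prems(4)[of e'] by (auto intro: Ints_diff)
      show "?\<beta> \<notin> ?\<Lambda>"
        using subgrpD(4)[OF L, of ?\<beta> "of_int j *\<^sub>R m"] jm insert.prems(6) by auto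
    qed (use insert.prems(2) in auto)
    then obtain \<eta> where \<eta>: "\<And>x. x \<in> ?\<Lambda> \<Longrightarrow> \<eta> \<bullet> x \<in> \<int>" "\<eta> \<bullet> ?\<beta> \<notin> \<int>" by blast
    \<comment> \<open>Subtracting this multiple of the coordinate at \<open>e\<close> keeps all
      values on the hyperplane and makes the value at \<open>m\<close> zero. If
      \<open>m $ e = 0\<close>, the quotient is 0 by convention, so \<open>\<eta>'\<close> is
      \<open>\<eta>\<close>, and \<open>m\<close> itself lies in \<open>?\<Lambda>\<close>, where
      \<open>\<eta>\<close> is integral.\<close>
    define \<eta>' where "\<eta>' = \<eta> - (\<eta> \<bullet> m / m $ e) *\<^sub>R axis e 1"
    have \<eta>': "\<eta>' \<bullet> x = \<eta> \<bullet> x - \<eta> \<bullet> m / m $ e * x $ e" for x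
      by (simp add: \<eta>'_def inner_diff_left inner_axis')
    have \<eta>m: "\<eta>' \<bullet> m \<in> \<int>" using \<eta>(1)[of m] m(1) by (cases "m $ e = 0") (auto simp: \<eta>')
    have "\<eta>' \<bullet> x \<in> \<int>" if x: "x \<in> \<Lambda>" for x
    proof -
      obtain i :: int where i: "x $ e = of_int i * m $ e" using mult[OF x] by blast
      let ?y = "x - of_int i *\<^sub>R m"
      have "?y \<in> ?\<Lambda>" using i subgrpD(2)[OF L x jm] by simp
      hence "\<eta>' \<bullet> ?y \<in> \<int>" using \<eta>(1)[of ?y] by (simp add: \<eta>')
      hence "\<eta>' \<bullet> ?y + of_int i * (\<eta>' \<bullet> m) \<in> \<int>" using \<eta>m by (intro Ints_add Ints_mult) auto
      thus ?thesis by (simp add: inner_diff_right)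
    qed
    moreover have "\<eta>' \<bullet> \<beta> \<notin> \<int>"
    proof
      assume "\<eta>' \<bullet> \<beta> \<in> \<int>"
      hence "\<eta>' \<bullet> \<beta> - of_int j * (\<eta>' \<bullet> m) \<in> \<int>" using \<eta>m by (intro Ints_diff Ints_mult) auto
      moreover have "\<eta>' \<bullet> ?\<beta> = \<eta> \<bullet> ?\<beta>" using j by (simp add: \<eta>'[of ?\<beta>])
      ultimately show False using \<eta>(2) by (simp add: inner_diff_right)
    qed
    ultimately show ?thesis by blast
  next
    case False
    show ?thesis
    proof (cases "m $ e = 0")
      case True
      hence b: "\<beta> $ e \<noteq> 0" using False by auto
      \<comment> \<open>Here the coordinate at \<open>e\<close> vanishes on all of
        \<open>\<Lambda>\<close>, so it may be scaled freely; this factor makes its value at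
        \<open>\<beta>\<close> equal to 1/2.\<close>
      let ?\<eta> = "(1 / (2 * \<beta> $ e)) *\<^sub>R axis e 1 :: real ^ 'e"
      have "?\<eta> \<bullet> x \<in> \<int>" if "x \<in> \<Lambda>" for x using mult[OF that] True by (auto simp: inner_axis')
      moreover have "?\<eta> \<bullet> \<beta> \<notin> \<int>"
      proof -
        have "?\<eta> \<bullet> \<beta> = 1 / 2" using b by (simp add: inner_axis')
        thus ?thesis using Ints_nonzero_abs_less1[of "1 / 2 :: real"] by auto
      qed
      ultimately show ?thesis by blast
    next
      case m0: False
      \<comment> \<open>Normalized so that its values on \<open>\<Lambda>\<close> are the integral
        multipliers relative to \<open>m\<close>; for \<open>\<beta>\<close> no such multiplier
        exists.\<close>
      let ?\<eta> = "(1 / m $ e) *\<^sub>R axis e 1 :: real ^ 'e"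
      have "?\<eta> \<bullet> x \<in> \<int>" if "x \<in> \<Lambda>" for x using mult[OF that] m0 by (auto simp: inner_axis')
      moreover have "?\<eta> \<bullet> \<beta> \<notin> \<int>"
      proof
        assume "?\<eta> \<bullet> \<beta> \<in> \<int>"
        then obtain j :: int where "?\<eta> \<bullet> \<beta> = of_int j" by (auto elim: Ints_cases)
        hence "\<beta> $ e = of_int j * m $ e" using m0 by (simp add: inner_axis' field_simps)
        thus False using False by blast
      qed
      ultimately show ?thesis by blast
    qed
  qed
qed

text \<open>Translation by \<open>z\<close> permutes the cosets and multiplies every summand by
  \<open>c\<close>, so the sum equals \<open>c\<close> times itself.\<close>

lemma sum_character_cosets_eq_0:
  fixes g :: "'a::ab_group_add set \<Rightarrow> complex"
  assumes M: "subgrp M" and z: "z \<in> M" "c \<noteq> 1"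
    and g: "\<And>x. x \<in> M \<Longrightarrow> g (coset L (z + x)) = c * g (coset L x)"
  shows "(\<Sum>X\<in>coset L ` M. g X) = 0"
proof -
  have t: "(+) z ` coset L x = coset L (z + x)" for x by (simp add: coset_def image_image add.assoc)
  have "bij_betw ((`) ((+) z)) (coset L ` M) (coset L ` M)"
    unfolding bij_betw_def
  proof
    show "inj_on ((`) ((+) z)) (coset L ` M)"
      by (rule inj_on_subset[of _ UNIV]) (auto intro!: inj_on_image)
    have "x \<in> (+) z ` M" if "x \<in> M" for x
      using subgrpD(2)[OF M that z(1)] by (simp add: mem_translate_iff)
    hence "(+) z ` M = M" using subgrpD(4)[OF M z(1)] by blast
    moreover have "(`) ((+) z) ` coset L ` M = coset L ` (+) z ` M" by (simp add: image_image t)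
    ultimately show "(`) ((+) z) ` coset L ` M = coset L ` M" by simp
  qed
  hence "(\<Sum>X\<in>coset L ` M. g X) = (\<Sum>X\<in>coset L ` M. g ((+) z ` X))"
    by (rule sum.reindex_bij_betw[symmetric])
  also have "\<dots> = (\<Sum>X\<in>coset L ` M. c * g X)" by (intro sum.cong) (auto simp: t g)
  finally show ?thesis using z(2) by (simp flip: sum_distrib_left)
qed

section \<open>Finite quotients\<close>

text \<open>A functional separating \<open>\<beta>\<close> from \<open>\<Lambda>\<close> need
  neither vanish off the arcs nor be harmonic. Restricting it to the arcs and taking the harmonic
  part changes no value on cycles.\<close>

lemma exists_separating_dual:
  fixes G :: "('v,'e::finite) pre_digraph"
  assumes G: "fin_digraph G" and \<Lambda>: "subgrp \<Lambda>" "\<Lambda> \<subseteq> H1 G" and \<beta>: "\<beta> \<in> H1 G" "\<beta> \<notin> \<Lambda>"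
  shows "\<exists>\<eta>\<in>dual_lattice G \<Lambda>. \<eta> \<bullet> \<beta> \<notin> \<int>"
proof -
  have "\<exists>\<eta>. (\<forall>x\<in>\<Lambda>. \<eta> \<bullet> x \<in> \<int>) \<and> \<eta> \<bullet> \<beta> \<notin> \<int>"
    by (rule separate_integral_subgroup[of UNIV]) (use assms in \<open>auto simp: H1_eq\<close>)
  then obtain \<eta> where \<eta>: "\<And>x. x \<in> \<Lambda> \<Longrightarrow> \<eta> \<bullet> x \<in> \<int>" "\<eta> \<bullet> \<beta> \<notin> \<int>" by blast
  define \<kappa> :: "real ^ 'e" where "\<kappa> = (\<chi> e. if e \<in> arcs G then \<eta> $ e else 0)"
  have \<kappa>: "\<kappa> \<in> one_forms G" by (simp add: \<kappa>_def one_forms_def)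
  have eq: "harmonic_part G \<kappa> \<bullet> \<alpha> = \<eta> \<bullet> \<alpha>" if \<alpha>: "\<alpha> \<in> H1 G" for \<alpha>
  proof -
    have "harmonic_part G \<kappa> \<bullet> \<alpha> = \<kappa> \<bullet> \<alpha>"
      using \<alpha> H1_subset_harmonic by (intro inner_harmonic_part[OF G \<kappa>]) auto
    also have "\<dots> = \<eta> \<bullet> \<alpha>"
      unfolding inner_vec_def using \<alpha> by (intro sum.cong) (auto simp: \<kappa>_def H1_def chains_def)
    finally show ?thesis .
  qed
  have "harmonic_part G \<kappa> \<in> dual_lattice G \<Lambda>"
    using harmonic_part(1)[OF G \<kappa>] eq \<eta>(1) \<Lambda>(2) by (auto simp: dual_lattice_def)
  thus ?thesis using eq[OF \<beta>(1)] \<eta>(2) by (intro bexI[of _ "harmonic_part G \<kappa>"]) auto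
qed

text \<open>Pigeonhole: two multiples of \<open>x\<close> lie in one coset of \<open>L\<close>, and
  their difference is the required multiple.\<close>

lemma exists_multiple_mem:
  fixes x :: "'a::real_vector"
  assumes L: "subgrp L" and M: "subgrp M" "finite (coset L ` M)" and x: "x \<in> M"
  shows "\<exists>k>0. of_nat k *\<^sub>R x \<in> L"
proof -
  have "of_nat n *\<^sub>R x \<in> M" for n using subgrp_of_int_scaleR[OF M(1) x, of "int n"] by simp
  hence "range (\<lambda>n::nat. coset L (of_nat n *\<^sub>R x)) \<subseteq> coset L ` M" by auto
  hence "\<not> inj (\<lambda>n::nat. coset L (of_nat n *\<^sub>R x))"
    using M(2) finite_subset range_inj_infinite by blast
  then obtain m n :: nat where mn: "m < n" "coset L (of_nat m *\<^sub>R x) = coset L (of_nat n *\<^sub>R x)"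
    unfolding inj_def by (metis linorder_neqE_nat)
  have "of_nat n *\<^sub>R x - of_nat m *\<^sub>R x \<in> L" using mn(2)[symmetric] by (simp add: coset_eq_iff[OF L])
  moreover have "of_nat n *\<^sub>R x - of_nat m *\<^sub>R x = of_nat (n - m) *\<^sub>R x"
    using mn(1) by (simp add: of_nat_diff scaleR_diff_left)
  ultimately show ?thesis using mn(1) by (intro exI[of _ "n - m"]) auto
qed

lemma chr_of_nat: "chr \<omega> (of_nat k *\<^sub>R \<alpha>) = chr \<omega> \<alpha> ^ k"
  by (induction k) (auto simp: scaleR_add_left chr_add)

text \<open>Double summation needs a function of two cosets. Arbitrary representatives suffice,
  because on \<open>quot_dual\<close> and \<open>quot\<close> the value does not depend on
  them.\<close>

definition class_pairing :: "(real ^ 'e::finite) set \<Rightarrow> (real ^ 'e) set \<Rightarrow> complex" where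
  "class_pairing X A = chr (SOME \<eta>. \<eta> \<in> X) (SOME \<alpha>. \<alpha> \<in> A)"

lemma chr_dual_lattice: "\<eta> \<in> dual_lattice G \<Lambda> \<Longrightarrow> \<alpha> \<in> \<Lambda> \<Longrightarrow> chr \<eta> \<alpha> = 1"
  by (simp add: chr_eq_1_iff dual_lattice_def)

locale finite_index_lattice =
  fixes G :: "('v,'e::finite) pre_digraph" and \<Lambda> :: "(real ^ 'e) set"
  assumes G: "fin_digraph G" and fi: "finite_index_subgroup G \<Lambda>"
begin

abbreviation "D \<equiv> dual_lattice G (H1 G)"
abbreviation "P \<equiv> quot_dual G \<Lambda>"
abbreviation "Q \<equiv> quot G \<Lambda>"

lemmas Lam = finite_index_subgroupD[OF fi]

lemma pairing_eq:
  assumes \<eta>: "\<eta> \<in> dual_lattice G \<Lambda>" and \<beta>: "\<beta> \<in> H1 G"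
  shows "class_pairing (coset D \<eta>) (coset \<Lambda> \<beta>) = chr \<eta> \<beta>"
proof -
  let ?\<eta> = "SOME x. x \<in> coset D \<eta>" and ?\<beta> = "SOME x. x \<in> coset \<Lambda> \<beta>"
  have "?\<eta> \<in> coset D \<eta>" using self_in_coset[OF subgrp_dual_lattice] by (rule someI)
  hence 1: "?\<eta> - \<eta> \<in> D" by (simp add: mem_coset_iff)
  have "?\<beta> \<in> coset \<Lambda> \<beta>" using self_in_coset[OF Lam(1)] by (rule someI)
  hence 2: "?\<beta> - \<beta> \<in> \<Lambda>" by (simp add: mem_coset_iff)
  hence "?\<beta> \<in> H1 G" using Lam(2) subgrpD(4)[OF subgrp_H1, of "?\<beta> - \<beta>" G \<beta>] \<beta> by auto
  hence "chr ?\<eta> ?\<beta> = chr \<eta> ?\<beta>" using 1 by (simp add: chr_eq_iff dual_lattice_def)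
  also have "\<dots> = chr \<eta> \<beta> * chr \<eta> (?\<beta> - \<beta>)" by (simp flip: chr_add)
  also have "chr \<eta> (?\<beta> - \<beta>) = 1" using \<eta> 2 by (simp add: chr_eq_1_iff dual_lattice_def)
  finally show ?thesis by (simp add: class_pairing_def)
qed

text \<open>A nontrivial class is nonintegral on some cycle by the very definition of the dual
  lattice, and translating by that cycle makes the sum vanish.\<close>

lemma sum_pairing_Q:
  assumes \<eta>: "\<eta> \<in> dual_lattice G \<Lambda>"
  shows "(\<Sum>A\<in>Q. class_pairing (coset D \<eta>) A) = (if coset D \<eta> = coset D 0 then of_nat (card Q) else 0)"
proof (cases "\<eta> \<in> D")
  case True
  have "class_pairing (coset D \<eta>) A = 1" if "A \<in> Q" for A
    using that by (auto simp: quot_def pairing_eq[OF \<eta>] chr_dual_lattice[OF True])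
  thus ?thesis using True by (simp add: coset_eq_iff[OF subgrp_dual_lattice])
next
  case False
  then obtain \<beta> where \<beta>: "\<beta> \<in> H1 G" "\<eta> \<bullet> \<beta> \<notin> \<int>" using \<eta> by (auto simp: dual_lattice_def)
  have "chr \<eta> \<beta> \<noteq> 1" using \<beta>(2) by (simp add: chr_eq_1_iff)
  moreover have "class_pairing (coset D \<eta>) (coset \<Lambda> (\<beta> + x)) = chr \<eta> \<beta> * class_pairing (coset D \<eta>) (coset \<Lambda> x)"
    if "x \<in> H1 G" for x
    using that \<beta>(1) \<eta> by (simp add: pairing_eq H1_closed(2) chr_add)
  ultimately have "(\<Sum>A\<in>Q. class_pairing (coset D \<eta>) A) = 0"
    unfolding quot_def by (rule sum_character_cosets_eq_0[OF subgrp_H1 \<beta>(1)])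
  thus ?thesis using False by (simp add: coset_eq_iff[OF subgrp_dual_lattice])
qed

text \<open>Here the form that detects a nontrivial class is not supplied by a definition; it comes
  from the separation of integral subgroups.\<close>

lemma sum_pairing_P:
  assumes \<beta>: "\<beta> \<in> H1 G"
  shows "(\<Sum>X\<in>P. class_pairing X (coset \<Lambda> \<beta>)) = (if coset \<Lambda> \<beta> = coset \<Lambda> 0 then of_nat (card P) else 0)"
proof (cases "\<beta> \<in> \<Lambda>")
  case True
  have "class_pairing X (coset \<Lambda> \<beta>) = 1" if "X \<in> P" for X
    using that by (auto simp: quot_dual_def pairing_eq[OF _ \<beta>] chr_dual_lattice[OF _ True])
  thus ?thesis using True by (simp add: coset_eq_iff[OF Lam(1)])
next
  case False
  then obtain \<eta> where \<eta>: "\<eta> \<in> dual_lattice G \<Lambda>" "\<eta> \<bullet> \<beta> \<notin> \<int>"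
    using exists_separating_dual[OF G Lam(1,2) \<beta>] by blast
  have "chr \<eta> \<beta> \<noteq> 1" using \<eta>(2) by (simp add: chr_eq_1_iff)
  moreover have "class_pairing (coset D (\<eta> + x)) (coset \<Lambda> \<beta>) = chr \<eta> \<beta> * class_pairing (coset D x) (coset \<Lambda> \<beta>)"
    if "x \<in> dual_lattice G \<Lambda>" for x
    using that \<beta> \<eta>(1) subgrpD(4)[OF subgrp_dual_lattice \<eta>(1) that] by (simp add: pairing_eq chr_add_left)
  ultimately have "(\<Sum>X\<in>P. class_pairing X (coset \<Lambda> \<beta>)) = 0"
    unfolding quot_dual_def by (rule sum_character_cosets_eq_0[OF subgrp_dual_lattice \<eta>(1)])
  thus ?thesis using False by (simp add: coset_eq_iff[OF Lam(1)])
qed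

text \<open>A class is determined by its pairings with the finitely many elements of
  \<open>Q\<close>. Each pairing is a root of unity of an order fixed by that element, since some
  multiple of every cycle lies in \<open>\<Lambda>\<close>. Finiteness must precede the double
  count, as sums and cardinalities of infinite sets default to 0.\<close>

lemma finite_P: "finite P"
proof -
  have "\<exists>k>0. \<forall>X\<in>P. class_pairing X A ^ k = 1" if "A \<in> Q" for A
  proof -
    obtain \<beta> where \<beta>: "\<beta> \<in> H1 G" "A = coset \<Lambda> \<beta>" using \<open>A \<in> Q\<close> by (auto simp: quot_def)
    obtain k where k: "k > 0" "of_nat k *\<^sub>R \<beta> \<in> \<Lambda>"
      using exists_multiple_mem[OF Lam(1) subgrp_H1 _ \<beta>(1)] Lam(3) by (auto simp: quot_def)
    have "class_pairing X A ^ k = 1" if "X \<in> P" for X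

      using that by (auto simp: quot_dual_def \<beta>(2) pairing_eq[OF _ \<beta>(1)] chr_dual_lattice[OF _ k(2)] simp flip: chr_of_nat)
    thus ?thesis using k(1) by blast
  qed
  then obtain k where k: "\<And>A. A \<in> Q \<Longrightarrow> k A > 0" "\<And>A X. A \<in> Q \<Longrightarrow> X \<in> P \<Longrightarrow> class_pairing X A ^ k A = 1"
    by metis
  let ?f = "\<lambda>X. \<lambda>A\<in>Q. class_pairing X A"
  have "inj_on ?f P"
  proof (rule inj_onI)
    fix X Y assume XY: "X \<in> P" "Y \<in> P" and eq: "?f X = ?f Y"
    then obtain \<eta> \<theta> where h: "\<eta> \<in> dual_lattice G \<Lambda>" "X = coset D \<eta>" "\<theta> \<in> dual_lattice G \<Lambda>" "Y = coset D \<theta>"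
      by (auto simp: quot_dual_def)
    have "(\<eta> - \<theta>) \<bullet> \<beta> \<in> \<int>" if \<beta>: "\<beta> \<in> H1 G" for \<beta>
    proof -
      have "coset \<Lambda> \<beta> \<in> Q" using \<beta> by (simp add: quot_def)
      hence "class_pairing X (coset \<Lambda> \<beta>) = class_pairing Y (coset \<Lambda> \<beta>)"
        using fun_cong[OF eq, of "coset \<Lambda> \<beta>"] by simp
      thus ?thesis using h \<beta> by (simp add: pairing_eq chr_eq_iff)
    qed
    moreover have "\<eta> - \<theta> \<in> harmonic_forms G"
      using h subspace_diff[OF subspace_harmonic] by (auto simp: dual_lattice_def)
    ultimately have "\<eta> - \<theta> \<in> D" unfolding dual_lattice_def by blast
    thus "X = Y" by (simp only: h(2,4) coset_eq_iff[OF subgrp_dual_lattice])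
  qed
  moreover have "?f ` P \<subseteq> (\<Pi>\<^sub>E A\<in>Q. {z. z ^ k A = 1})" using k(2) by auto
  moreover have "finite (\<Pi>\<^sub>E A\<in>Q. {z::complex. z ^ k A = 1})"
    using k(1) Lam(3) by (intro finite_PiE) (auto intro!: finite_roots_unity simp: Suc_le_eq)
  ultimately show ?thesis by (rule inj_on_finite)
qed

lemma card_P: "card P = card Q"
proof -
  have 0: "coset D 0 \<in> P" "coset \<Lambda> 0 \<in> Q"
    using subgrpD(1)[OF subgrp_dual_lattice] H1_closed(1) by (auto simp: quot_dual_def quot_def)
  have "(\<Sum>X\<in>P. \<Sum>A\<in>Q. class_pairing X A) = (\<Sum>X\<in>P. if X = coset D 0 then of_nat (card Q) else 0)"
  proof (rule sum.cong[OF refl])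
    fix X assume "X \<in> P"
    then obtain \<eta> where "\<eta> \<in> dual_lattice G \<Lambda>" "X = coset D \<eta>" by (auto simp: quot_dual_def)
    thus "(\<Sum>A\<in>Q. class_pairing X A) = (if X = coset D 0 then of_nat (card Q) else 0)"
      by (simp only: sum_pairing_Q)
  qed
  hence "(\<Sum>X\<in>P. \<Sum>A\<in>Q. class_pairing X A) = of_nat (card Q)" using 0 finite_P by simp
  moreover have "(\<Sum>A\<in>Q. \<Sum>X\<in>P. class_pairing X A) = (\<Sum>A\<in>Q. if A = coset \<Lambda> 0 then of_nat (card P) else 0)"
  proof (rule sum.cong[OF refl])
    fix A assume "A \<in> Q"
    then obtain \<beta> where "\<beta> \<in> H1 G" "A = coset \<Lambda> \<beta>" by (auto simp: quot_def)
    thus "(\<Sum>X\<in>P. class_pairing X A) = (if A = coset \<Lambda> 0 then of_nat (card P) else 0)"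
      by (simp only: sum_pairing_P)
  qed
  hence "(\<Sum>A\<in>Q. \<Sum>X\<in>P. class_pairing X A) = of_nat (card P)" using 0 Lam(3) by simp
  moreover have "(\<Sum>X\<in>P. \<Sum>A\<in>Q. class_pairing X A) = (\<Sum>A\<in>Q. \<Sum>X\<in>P. class_pairing X A)"
    by (rule sum.swap)
  ultimately have "(of_nat (card P) :: complex) = of_nat (card Q)" by simp
  thus ?thesis by (simp only: of_nat_eq_iff)
qed

lemma card_Q_pos: "card Q > 0"
proof -
  have "coset \<Lambda> 0 \<in> Q" unfolding quot_def by (intro imageI H1_closed(1))
  thus ?thesis using Lam(3) card_gt_0_iff by blast
qed

text \<open>Orthogonality in the form that selects the circuits of one class, with the size of the
  dual already replaced by that of \<open>Q\<close>.\<close>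

lemma sum_chr_diff:
  assumes "\<alpha> \<in> H1 G" "\<beta> \<in> H1 G"
  shows "(\<Sum>X\<in>P. class_pairing X (coset \<Lambda> (\<beta> - \<alpha>))) = of_nat (card Q) * of_bool (coset \<Lambda> \<beta> = coset \<Lambda> \<alpha>)"
  using sum_pairing_P[OF H1_closed(3)[OF assms(2,1)]] by (simp add: coset_eq_iff[OF Lam(1)] card_P)

end

section \<open>The four identities\<close>

lemma spec_sum_character_sums:
  assumes es: "distinct es" "set es = arcs G" and tf: "test_function G es {\<omega>} \<epsilon> h \<gamma>"
  shows "(\<lambda>l. \<Sum>\<^sub>\<infinity>\<alpha>\<in>H1 G. chr \<omega> \<alpha> * of_nat (num_circuits G \<alpha> (Suc l)) * coef h \<gamma> (Suc l))
          sums spec_sum G es h \<omega>"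
  unfolding infsum_num_circuits by (rule spec_sum_sums[OF es tf]) simp

lemma integral_spec_sum:
  fixes G :: "('v,'e::finite) pre_digraph"
  assumes G: "fin_digraph G" and conn: "Digraph_Component.connected G"
    and es: "distinct es" "set es = arcs G" and \<alpha>: "\<alpha> \<in> H1 G"
    and tf: "test_function G es (one_forms G) \<epsilon> h \<gamma>"
  defines "\<phi> \<equiv> on_class G (\<lambda>\<omega>. chr (- \<omega>) \<alpha> * spec_sum G es h \<omega>)"
    and "N \<equiv> (\<lambda>l. of_nat (num_circuits G \<alpha> (Suc l)) * coef h \<gamma> (Suc l))"
  shows "integrable (dV G) \<phi>" "summable N"
    "integral\<^sup>L (dV G) \<phi> = of_real (measure (dV G) (char_torus G)) * suminf N"
proof -
  let ?V = "harmonic_forms G" and ?L = "dual_lattice G (H1 G)" and ?M = "dV G"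
  obtain d where "cocompact_subgroup ?V ?L d (real CARD('e))"
    using cocompact_dual_lattice[OF G conn] by blast
  then interpret cocompact_subgroup ?V ?L d "real CARD('e)" .
  have dV: "?M = quotient_volume ?V ?L" by (simp add: dV_def)
  have space: "space ?M = coset ?L ` ?V" by (simp add: dV space_nu)
  have zero: "0 \<in> one_forms G" by (rule subspace_0[OF subspace_one_forms])
  have sc: "summable (\<lambda>l. norm (coef h \<gamma> (Suc l)) * real (card (circuits G (Suc l))))"
    by (rule summable_coef_card_circuits[OF es tf zero])
  \<comment> \<open>Characters as functions on the torus, so that each term of the circuit series
    lives on classes rather than on forms.\<close>
  define \<psi> where "\<psi> \<beta> = on_class G (\<lambda>\<omega>. chr \<omega> \<beta>)" for \<beta>
  have \<psi>: "\<psi> \<beta> (coset ?L \<eta>) = chr \<eta> \<beta>" if "\<beta> \<in> H1 G" "\<eta> \<in> ?V" for \<beta> \<eta>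
    unfolding \<psi>_def using that by (intro on_class_eq[OF G]) auto
  \<comment> \<open>The \<open>l\<close>-th term of the integrand, with the factor
    \<open>chr (- \<omega>) \<alpha>\<close> absorbed into the argument
    \<open>abelianization c - \<alpha>\<close>.\<close>
  define f where "f l x = coef h \<gamma> (Suc l) * (\<Sum>c\<in>circuits G (Suc l). \<psi> (abelianization c - \<alpha>) x)" for l x
  have diff: "abelianization c - \<alpha> \<in> H1 G" if "c \<in> circuits G l" for c l
    by (rule H1_closed(3)[OF abelianization_circuit[OF that] \<alpha>])
  have \<psi>int: "integrable ?M (\<psi> (abelianization c - \<alpha>))"
    "integral\<^sup>L ?M (\<psi> (abelianization c - \<alpha>)) =
      (if abelianization c = \<alpha> then of_real (measure ?M (char_torus G)) else 0)"
    if "c \<in> circuits G l" for c l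
    using integral_character[OF G conn diff[OF that] \<psi>[OF diff[OF that]]] by auto
  have fint: "integrable ?M (f l)" for l
    unfolding f_def by (intro integrable_mult_right Bochner_Integration.integrable_sum \<psi>int)
  \<comment> \<open>Uniform in \<open>x\<close> and summable in \<open>l\<close> by
    \<open>sc\<close>; on a space of finite measure this permits exchanging sum and
    integral.\<close>
  have normf: "norm (f l x) \<le> norm (coef h \<gamma> (Suc l)) * real (card (circuits G (Suc l)))"
    if x: "x \<in> space ?M" for l x
  proof -
    have "norm (\<psi> (abelianization c - \<alpha>) x) \<le> 1" if "c \<in> circuits G (Suc l)" for c
      using x diff[OF that] by (auto simp: space \<psi>)
    hence "norm (\<Sum>c\<in>circuits G (Suc l). \<psi> (abelianization c - \<alpha>) x) \<le> real (card (circuits G (Suc l))) * 1"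
      by (intro sum_norm_bound[of _ _ 1, THEN order_trans]) auto
    thus ?thesis unfolding f_def norm_mult by (intro mult_left_mono) auto
  qed
  have fsum: "summable (\<lambda>l. norm (f l x))" if x: "x \<in> space ?M" for x
    by (rule summable_comparison_test'[OF sc, of 0]) (use normf[OF x] in simp)
  have \<phi>f: "\<phi> x = (\<Sum>l. f l x)" if x: "x \<in> space ?M" for x
  proof -
    obtain \<eta> where \<eta>: "\<eta> \<in> ?V" "x = coset ?L \<eta>" using x by (auto simp: space)
    have o: "\<eta> \<in> one_forms G" using \<eta> harmonic_subset by auto
    have "\<phi> x = chr (- \<eta>) \<alpha> * spec_sum G es h \<eta>"
      unfolding \<phi>_def \<eta>(2)
    proof (rule on_class_eq[OF G \<eta>(1)])
      fix \<omega> assume \<omega>: "\<omega> \<in> one_forms G" "\<And>\<alpha>. \<alpha> \<in> H1 G \<Longrightarrow> chr \<omega> \<alpha> = chr \<eta> \<alpha>"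
      have "chr (- \<omega>) \<alpha> = chr (- \<eta>) \<alpha>"
        using \<omega>(2)[of "-\<alpha>"] subgrpD(3)[OF subgrp_H1 \<alpha>] by (simp add: chr_minus_minus)
      thus "chr (- \<omega>) \<alpha> * spec_sum G es h \<omega> = chr (- \<eta>) \<alpha> * spec_sum G es h \<eta>"
        using spec_sum_cong[OF es tf \<omega>(1) o \<omega>(2)] by simp
    qed
    moreover have "(\<lambda>l. f l x) sums (chr (- \<eta>) \<alpha> * spec_sum G es h \<eta>)"
    proof -
      have "f l x = chr (- \<eta>) \<alpha> * (coef h \<gamma> (Suc l) * (\<Sum>c\<in>circuits G (Suc l). chr \<eta> (abelianization c)))" for l
      proof -
        have "(\<Sum>c\<in>circuits G (Suc l). \<psi> (abelianization c - \<alpha>) x) =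
            (\<Sum>c\<in>circuits G (Suc l). chr (- \<eta>) \<alpha> * chr \<eta> (abelianization c))"
          by (intro sum.cong) (auto simp: \<eta> \<psi> diff chr_minus_minus simp flip: chr_add)
        thus ?thesis by (simp add: f_def sum_distrib_left mult_ac)
      qed
      thus ?thesis using sums_mult[OF spec_sum_sums[OF es tf o]] by simp
    qed
    ultimately show ?thesis by (simp add: sums_iff)
  qed
  have ae: "AE x in ?M. summable (\<lambda>l. norm (f l x))" using fsum by (intro AE_I2) auto
  have si: "summable (\<lambda>l. \<integral>x. norm (f l x) \<partial>?M)"
  proof (rule summable_comparison_test'[of _ 0])
    show "summable (\<lambda>l. norm (coef h \<gamma> (Suc l)) * real (card (circuits G (Suc l))) * measure ?M (space ?M))"
      by (rule summable_mult2[OF sc])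
    fix l :: nat
    have "(\<integral>x. norm (f l x) \<partial>?M) \<le> (\<integral>x. norm (coef h \<gamma> (Suc l)) * real (card (circuits G (Suc l))) \<partial>?M)"
      using fint normf unfolding dV by (intro integral_mono) auto
    also have "\<dots> = norm (coef h \<gamma> (Suc l)) * real (card (circuits G (Suc l))) * measure ?M (space ?M)" by simp
    finally show "norm (\<integral>x. norm (f l x) \<partial>?M) \<le> norm (coef h \<gamma> (Suc l)) * real (card (circuits G (Suc l))) * measure ?M (space ?M)"
      by simp
  qed
  show "integrable ?M \<phi>"
    using integrable_suminf[OF fint ae si] \<phi>f by (subst Bochner_Integration.integrable_cong[OF refl \<phi>f]) auto
  have Nle: "norm (N l) \<le> norm (coef h \<gamma> (Suc l)) * real (card (circuits G (Suc l)))" for l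
  proof -
    have "num_circuits G \<alpha> (Suc l) \<le> card (circuits G (Suc l))"
      unfolding num_circuits_eq by (intro card_mono) auto
    thus ?thesis
      unfolding N_def norm_mult norm_of_nat mult.commute[of "norm (coef h \<gamma> (Suc l))"]
      by (intro mult_right_mono) simp_all
  qed
  show sN: "summable N" by (rule summable_comparison_test'[OF sc, of 0]) (use Nle in simp)
  have fi: "integral\<^sup>L ?M (f l) = of_real (measure ?M (char_torus G)) * N l" for l
  proof -
    let ?m = "complex_of_real (measure ?M (char_torus G))"
    have "integral\<^sup>L ?M (f l) = coef h \<gamma> (Suc l) * (\<Sum>c\<in>circuits G (Suc l). integral\<^sup>L ?M (\<psi> (abelianization c - \<alpha>)))"
      unfolding f_def
      by (subst integral_mult_right_zero, subst Bochner_Integration.integral_sum)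
         (auto intro: \<psi>int)
    also have "(\<Sum>c\<in>circuits G (Suc l). integral\<^sup>L ?M (\<psi> (abelianization c - \<alpha>))) =
        (\<Sum>c\<in>circuits G (Suc l). if abelianization c = \<alpha> then ?m else 0)"
      by (intro sum.cong refl \<psi>int(2))
    also have "\<dots> = of_nat (num_circuits G \<alpha> (Suc l)) * ?m"
      by (simp add: num_circuits_eq sum.inter_filter[symmetric])
    finally show ?thesis by (simp add: N_def mult_ac)
  qed
  have "integral\<^sup>L ?M \<phi> = (\<integral>x. (\<Sum>l. f l x) \<partial>?M)"
    by (intro Bochner_Integration.integral_cong refl \<phi>f)
  also have "\<dots> = (\<Sum>l. integral\<^sup>L ?M (f l))" by (rule integral_suminf[OF fint ae si])
  also have "\<dots> = of_real (measure ?M (char_torus G)) * suminf N"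
    unfolding fi by (rule suminf_mult[OF sN])
  finally show "integral\<^sup>L ?M \<phi> = of_real (measure ?M (char_torus G)) * suminf N" .
qed

lemma spec_sum_quotient_sums:
  fixes G :: "('v,'e::finite) pre_digraph"
  assumes G: "fin_digraph G" and es: "distinct es" "set es = arcs G"
    and fi: "finite_index_subgroup G \<Lambda>"
    and \<omega>: "\<omega> \<in> one_forms G" "form_class G \<omega> \<in> quot_dual G \<Lambda>"
    and tf: "test_function G es {\<omega>} \<epsilon> h \<gamma>"
  shows "(\<lambda>l. \<Sum>A\<in>quot G \<Lambda>. chr_coset \<omega> A * of_nat (num_circuits_mod G \<Lambda> A (Suc l)) * coef h \<gamma> (Suc l))
             sums spec_sum G es h \<omega>"
proof -
  note Lam = finite_index_subgroupD[OF fi]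
  have "(\<Sum>A\<in>quot G \<Lambda>. chr_coset \<omega> A * of_nat (num_circuits_mod G \<Lambda> A l) * coef h \<gamma> l) =
      coef h \<gamma> l * (\<Sum>c\<in>circuits G l. chr \<omega> (abelianization c))" for l
  proof -
    have "(\<Sum>c\<in>circuits G l. chr_coset \<omega> (coset \<Lambda> (abelianization c))) =
        (\<Sum>A\<in>quot G \<Lambda>. chr_coset \<omega> A * of_nat (num_circuits_mod G \<Lambda> A l))"
      unfolding num_circuits_mod_eq using Lam(3)
      by (intro sum_fibres) (auto simp: quot_def intro: abelianization_circuit)
    thus ?thesis
      by (simp add: chr_coset_eq[OF Lam(1) quot_dual_chr[OF G fi \<omega>]] sum_distrib_left mult_ac)
  qed
  thus ?thesis using spec_sum_sums[OF es tf] by simp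
qed

lemma sum_spec_sum_quotient:
  fixes G :: "('v,'e::finite) pre_digraph"
  assumes G: "fin_digraph G" and es: "distinct es" "set es = arcs G"
    and fi: "finite_index_subgroup G \<Lambda>" and A: "A \<in> quot G \<Lambda>"
    and tf: "test_function G es {\<omega> \<in> one_forms G. form_class G \<omega> \<in> quot_dual G \<Lambda>} \<epsilon> h \<gamma>"
  defines "N \<equiv> (\<lambda>l. of_nat (num_circuits_mod G \<Lambda> A (Suc l)) * coef h \<gamma> (Suc l))"
  shows "summable N"
    and "(\<Sum>x\<in>quot_dual G \<Lambda>. on_class G (\<lambda>\<omega>. chr_coset (- \<omega>) A * spec_sum G es h \<omega>) x) =
             of_nat (card (quot G \<Lambda>)) * suminf N"
proof -
  interpret finite_index_lattice G \<Lambda> by (rule finite_index_lattice.intro[OF G fi])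
  let ?S = "{\<omega> \<in> one_forms G. form_class G \<omega> \<in> P}"
  define \<phi> where "\<phi> = on_class G (\<lambda>\<omega>. chr_coset (- \<omega>) A * spec_sum G es h \<omega>)"
  obtain \<alpha> where \<alpha>: "\<alpha> \<in> H1 G" "A = coset \<Lambda> \<alpha>" using A by (auto simp: quot_def)
  have cc: "chr_coset (- \<omega>) A = chr (- \<omega>) \<alpha>" if "\<omega> \<in> ?S" for \<omega>
    unfolding \<alpha>(2)
  proof (rule chr_coset_eq[OF Lam(1)])
    fix \<beta> assume "\<beta> \<in> \<Lambda>"
    thus "chr (- \<omega>) \<beta> = 1"
      using that subgrpD(3)[OF Lam(1)] quot_dual_chr[OF G fi, of \<omega> "-\<beta>"] by (simp add: chr_minus_minus)
  qed
  have "(\<lambda>l. coef h \<gamma> (Suc l) * (\<Sum>c\<in>circuits G (Suc l). class_pairing X (coset \<Lambda> (abelianization c - \<alpha>))))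
      sums \<phi> X" if X: "X \<in> P" for X
  proof -
    obtain \<eta> where \<eta>: "\<eta> \<in> dual_lattice G \<Lambda>" "X = coset D \<eta>" using X by (auto simp: quot_dual_def)
    have hV: "\<eta> \<in> harmonic_forms G" using \<eta> by (simp add: dual_lattice_def)
    have \<eta>S: "\<eta> \<in> ?S" using hV harmonic_subset X by (auto simp: form_class_harmonic[OF G hV] \<eta>(2))
    have "\<phi> X = chr_coset (- \<eta>) A * spec_sum G es h \<eta>"
      unfolding \<phi>_def \<eta>(2)
    proof (rule on_class_eq[OF G hV])
      fix \<omega> assume \<omega>: "\<omega> \<in> one_forms G" "\<And>\<alpha>. \<alpha> \<in> H1 G \<Longrightarrow> chr \<omega> \<alpha> = chr \<eta> \<alpha>" "form_class G \<omega> = coset D \<eta>"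
      have \<omega>S: "\<omega> \<in> ?S" using \<omega> X \<eta>(2) by simp
      have "chr (- \<omega>) \<alpha> = chr (- \<eta>) \<alpha>"
        using \<omega>(2)[of "-\<alpha>"] subgrpD(3)[OF subgrp_H1 \<alpha>(1)] by (simp add: chr_minus_minus)
      thus "chr_coset (- \<omega>) A * spec_sum G es h \<omega> = chr_coset (- \<eta>) A * spec_sum G es h \<eta>"
        using spec_sum_cong[OF es tf \<omega>S \<eta>S \<omega>(2)] by (simp only: cc[OF \<omega>S] cc[OF \<eta>S])
    qed
    hence \<phi>X: "\<phi> X = chr (- \<eta>) \<alpha> * spec_sum G es h \<eta>" by (simp only: cc[OF \<eta>S])
    have eq: "coef h \<gamma> (Suc l) * (\<Sum>c\<in>circuits G (Suc l). class_pairing X (coset \<Lambda> (abelianization c - \<alpha>))) =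
        chr (- \<eta>) \<alpha> * (coef h \<gamma> (Suc l) * (\<Sum>c\<in>circuits G (Suc l). chr \<eta> (abelianization c)))" for l
    proof -
      have "(\<Sum>c\<in>circuits G (Suc l). class_pairing X (coset \<Lambda> (abelianization c - \<alpha>))) =
          (\<Sum>c\<in>circuits G (Suc l). chr (- \<eta>) \<alpha> * chr \<eta> (abelianization c))"
      proof (rule sum.cong[OF refl])
        fix c assume "c \<in> circuits G (Suc l)"
        hence "abelianization c - \<alpha> \<in> H1 G" using abelianization_circuit \<alpha>(1) H1_closed(3) by blast
        thus "class_pairing X (coset \<Lambda> (abelianization c - \<alpha>)) = chr (- \<eta>) \<alpha> * chr \<eta> (abelianization c)"
          using \<eta> by (simp add: pairing_eq chr_minus_minus flip: chr_add)
      qed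
      thus ?thesis by (simp add: sum_distrib_left mult_ac)
    qed
    show ?thesis unfolding \<phi>X eq by (rule sums_mult[OF spec_sum_sums[OF es tf \<eta>S]])
  qed
  hence "(\<lambda>l. \<Sum>X\<in>P. coef h \<gamma> (Suc l) * (\<Sum>c\<in>circuits G (Suc l). class_pairing X (coset \<Lambda> (abelianization c - \<alpha>))))
      sums (\<Sum>X\<in>P. \<phi> X)"
    by (rule sums_sum)
  moreover have "(\<Sum>X\<in>P. coef h \<gamma> (Suc l) * (\<Sum>c\<in>circuits G (Suc l). class_pairing X (coset \<Lambda> (abelianization c - \<alpha>))))
      = of_nat (card Q) * N l" for l
  proof -
    have "(\<Sum>X\<in>P. coef h \<gamma> (Suc l) * (\<Sum>c\<in>circuits G (Suc l). class_pairing X (coset \<Lambda> (abelianization c - \<alpha>)))) =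
        coef h \<gamma> (Suc l) * (\<Sum>c\<in>circuits G (Suc l). \<Sum>X\<in>P. class_pairing X (coset \<Lambda> (abelianization c - \<alpha>)))"
      by (subst sum.swap) (simp add: sum_distrib_left)
    also have "(\<Sum>c\<in>circuits G (Suc l). \<Sum>X\<in>P. class_pairing X (coset \<Lambda> (abelianization c - \<alpha>))) =
        (\<Sum>c\<in>circuits G (Suc l). of_nat (card Q) * of_bool (coset \<Lambda> (abelianization c) = A))"
      unfolding \<alpha>(2) by (intro sum.cong refl sum_chr_diff \<alpha>(1) abelianization_circuit)
    also have "\<dots> = of_nat (card Q) * of_nat (num_circuits_mod G \<Lambda> A (Suc l))"
      by (simp add: num_circuits_mod_eq sum_distrib_left[symmetric] sum.inter_filter[symmetric] of_bool_def)
    finally show ?thesis by (simp add: N_def mult_ac)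
  qed
  ultimately have s: "(\<lambda>l. of_nat (card Q) * N l) sums (\<Sum>X\<in>P. \<phi> X)" by simp
  \<comment> \<open>So far only the series multiplied by \<open>card Q\<close> is known to converge,
    as a finite sum over \<open>P\<close> of convergent series. Dividing by the nonzero factor gives
    convergence of the counting series itself.\<close>
  have "(of_nat (card Q) :: complex) \<noteq> 0" using card_Q_pos by simp
  with sums_summable[OF s] show "summable N" by (rule summable_mult_D)
  thus "(\<Sum>X\<in>P. on_class G (\<lambda>\<omega>. chr_coset (- \<omega>) A * spec_sum G es h \<omega>) X) = of_nat (card Q) * suminf N"
    using s unfolding \<phi>_def[symmetric] by (simp add: sums_iff suminf_mult)
qed

theorem theorem3p11:
  fixes G :: "('v, 'e::finite) pre_digraph"
    and es :: "'e list"
    and h :: "complex \<Rightarrow> complex"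
    and \<gamma> :: "real \<Rightarrow> complex"
    and \<epsilon> :: real
  assumes "fin_digraph G"
    and "Digraph_Component.connected G"
    and "distinct es" and "set es = arcs G"
  shows
    "(\<forall>\<omega>\<in>one_forms G. test_function G es {\<omega>} \<epsilon> h \<gamma> \<longrightarrow>
        (\<lambda>l. \<Sum>\<^sub>\<infinity>\<alpha>\<in>H1 G. chr \<omega> \<alpha> * of_nat (num_circuits G \<alpha> (Suc l)) * coef h \<gamma> (Suc l))
          sums spec_sum G es h \<omega>) \<and>
     (\<forall>\<alpha>\<in>H1 G. test_function G es (one_forms G) \<epsilon> h \<gamma> \<longrightarrow>
        integrable (dV G) (on_class G (\<lambda>\<omega>. chr (- \<omega>) \<alpha> * spec_sum G es h \<omega>)) \<and>
        summable (\<lambda>l. of_nat (num_circuits G \<alpha> (Suc l)) * coef h \<gamma> (Suc l)) \<and>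
        (LINT x | dV G. on_class G (\<lambda>\<omega>. chr (- \<omega>) \<alpha> * spec_sum G es h \<omega>) x) =
          of_real (measure (dV G) (char_torus G)) *
          (\<Sum>l. of_nat (num_circuits G \<alpha> (Suc l)) * coef h \<gamma> (Suc l))) \<and>
     (\<forall>\<Lambda>. finite_index_subgroup G \<Lambda> \<longrightarrow>
        (\<forall>\<omega>\<in>one_forms G. form_class G \<omega> \<in> quot_dual G \<Lambda> \<longrightarrow> test_function G es {\<omega>} \<epsilon> h \<gamma> \<longrightarrow>
           (\<lambda>l. \<Sum>A\<in>quot G \<Lambda>. chr_coset \<omega> A * of_nat (num_circuits_mod G \<Lambda> A (Suc l)) *
                  coef h \<gamma> (Suc l))
             sums spec_sum G es h \<omega>)) \<and>
     (\<forall>\<Lambda>. finite_index_subgroup G \<Lambda> \<longrightarrow>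
        (\<forall>A\<in>quot G \<Lambda>.
           test_function G es {\<omega> \<in> one_forms G. form_class G \<omega> \<in> quot_dual G \<Lambda>} \<epsilon> h \<gamma> \<longrightarrow>
           summable (\<lambda>l. of_nat (num_circuits_mod G \<Lambda> A (Suc l)) * coef h \<gamma> (Suc l)) \<and>
           (\<Sum>x\<in>quot_dual G \<Lambda>. on_class G (\<lambda>\<omega>. chr_coset (- \<omega>) A * spec_sum G es h \<omega>) x) =
             of_nat (card (quot G \<Lambda>)) *
             (\<Sum>l. of_nat (num_circuits_mod G \<Lambda> A (Suc l)) * coef h \<gamma> (Suc l))))"
proof (intro conjI ballI allI impI)
  fix \<omega> assume "test_function G es {\<omega>} \<epsilon> h \<gamma>"
  thus "(\<lambda>l. \<Sum>\<^sub>\<infinity>\<alpha>\<in>H1 G. chr \<omega> \<alpha> * of_nat (num_circuits G \<alpha> (Suc l)) * coef h \<gamma> (Suc l))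
      sums spec_sum G es h \<omega>"
    by (rule spec_sum_character_sums[OF assms(3,4)])
qed (rule integral_spec_sum(1)[OF assms] integral_spec_sum(2)[OF assms] integral_spec_sum(3)[OF assms]
      spec_sum_quotient_sums[OF assms(1,3,4)] sum_spec_sum_quotient(1)[OF assms(1,3,4)]
      sum_spec_sum_quotient(2)[OF assms(1,3,4)], assumption+)+

end
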